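(* For every $\mathcal F\in\mathbb{S}\cap\mathbb{G}^1$, the Hausdorff dimension of $\Lambda(\mathcal F)$ and the limit capacity of $\Lambda(\mathcal F)$ are equal.
   Context: Let $\bar I$ be the closed unit ball in $\mathbb{R}^q$, $I$ its interior, and $H(\bar I)$ the space of nonempty compact subsets of $\bar I$ with the Hausdorff metric. Fix $0<L<1$ and $0<\alpha\le 1$. $D^{1+\alpha}_L(\bar I)$ is the set of diffeomorphisms $f$ from $\bar I$ onto $f(\bar I)\subseteq I$ with Lipschitz constant $L$ and with $\alpha$-Hölder continuous derivative, equipped with the $C^1$-metric $\|f-g\|_1=\sup_{x\in\bar I}(|f(x)-g(x)|+\|Df|_x-Dg|_x\|)$. A differentiable iterated function system is a map $\mathcal F:H(\bar I)\to H(\bar I)$, $\mathcal F(A)=\bigcup_{x\in A}\bigcup_{f\in\mathcal F}\{f(x)\}$, generated by a nonempty compact subset of $D^{1+\alpha}_L(\bar I)$, denoted by the same symbol $\mathcal F$, whose members have derivatives that are uniformly $\alpha$-Hölder (a common Hölder constant for all $f\in\mathcal F$). It is a contraction of $H(\bar I)$; $\Lambda(\mathcal F)$ denotes its unique fixed point. $\mathbb{G}^1$ is the space of differentiable iterated function systems. $\mathbb{S}\subset\mathbb{G}^1$ is the set of semi-conformal systems, i.e. those $\mathcal F$ with $$\lim_{n\to\infty}\ \max_{f_1,\dots,f_n\in\mathcal F,\ x_0\in\bar I}\ \frac1n\ln\left(\|D(f_n\cdots f_1)|_{x_0}\|\cdot\|(D(f_n\cdots f_1)|_{x_0})^{-1}\|\right)=0,$$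 where $f_n\cdots f_1$ denotes composition and $\|\cdot\|$ the operator norm. The limit capacity (upper box counting dimension) of a compact set $C\subset\mathbb{R}^q$ is $d_c(C)=\limsup_{\delta\to0}\frac{\ln\nu_C(\delta)}{-\ln\delta}$, where $\nu_C(\delta)$ is the minimum number of balls of radius $\delta$ needed to cover $C$. *)

theory Defs
  imports "HOL-Analysis.Analysis"
begin

section \<open>Diffeomorphisms of the closed unit ball onto their images\<close>

text \<open>
  Derivatives are taken within the set, hence one-sided on the boundary of the ball. They are
  unique there, because the closed ball is convex with nonempty interior. The norm on the
  codomain is the operator norm.
\<close>

definition deriv_on ::
    "'a::euclidean_space set \<Rightarrow> ('a \<Rightarrow> 'b::euclidean_space) \<Rightarrow> 'a \<Rightarrow> 'a \<Rightarrow>\<^sub>L 'b"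
  where "deriv_on S f x = Blinfun (frechet_derivative f (at x within S))"

definition C1_on :: "'a::euclidean_space set \<Rightarrow> ('a \<Rightarrow> 'b::euclidean_space) \<Rightarrow> bool"
  where "C1_on S f \<longleftrightarrow>
    (\<exists>f'. (\<forall>x\<in>S. (f has_derivative blinfun_apply (f' x)) (at x within S)) \<and> continuous_on S f')"

definition diffeo_onto_image :: "'a::euclidean_space set \<Rightarrow> ('a \<Rightarrow> 'a) \<Rightarrow> bool"
  where "diffeo_onto_image S f \<longleftrightarrow>
    inj_on f S \<and> C1_on S f \<and> C1_on (f ` S) (the_inv_into S f)"

definition hoelder_deriv_with ::
    "real \<Rightarrow> real \<Rightarrow> 'a::euclidean_space set \<Rightarrow> ('a \<Rightarrow> 'a) \<Rightarrow> bool"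
  where "hoelder_deriv_with \<alpha> C S f \<longleftrightarrow>
    (\<forall>x\<in>S. \<forall>y\<in>S. norm (deriv_on S f x - deriv_on S f y) \<le> C * norm (x - y) powr \<alpha>)"

text \<open>
  Maps with domain the closed ball are total functions that are constantly \<open>undefined\<close>
  off the ball, so that equality is equality of maps on the ball.
\<close>

definition D1 :: "real \<Rightarrow> real \<Rightarrow> ('a::euclidean_space \<Rightarrow> 'a) set"
  where "D1 L \<alpha> =
    {f \<in> extensional (cball 0 1).
       diffeo_onto_image (cball 0 1) f \<and> f ` cball 0 1 \<subseteq> ball 0 1 \<and>
       L-lipschitz_on (cball 0 1) f \<and> (\<exists>C. hoelder_deriv_with \<alpha> C (cball 0 1) f)}"

definition C1_dist :: "('a::euclidean_space \<Rightarrow> 'a) \<Rightarrow> ('a \<Rightarrow> 'a) \<Rightarrow> real"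
  where "C1_dist f g =
    (SUP x\<in>cball 0 1. norm (f x - g x) + norm (deriv_on (cball 0 1) f x - deriv_on (cball 0 1) g x))"

text \<open>
  The locale \<^locale>\<open>Metric_space\<close> asks for nonnegativity and symmetry on the whole type, whereas a
  real-valued supremum over an unbounded set is unspecified. The distance is therefore set
  to \<open>0\<close> outside \<^const>\<open>D1\<close>, which does not affect the topology.
\<close>

definition D1_dist :: "real \<Rightarrow> real \<Rightarrow> ('a::euclidean_space \<Rightarrow> 'a) \<Rightarrow> ('a \<Rightarrow> 'a) \<Rightarrow> real"
  where "D1_dist L \<alpha> f g = (if f \<in> D1 L \<alpha> \<and> g \<in> D1 L \<alpha> then C1_dist f g else 0)"

definition C1_topology :: "real \<Rightarrow> real \<Rightarrow> ('a::euclidean_space \<Rightarrow> 'a) topology"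
  where "C1_topology L \<alpha> = Metric_space.mtopology (D1 L \<alpha>) (D1_dist L \<alpha>)"

lemma D1_bdd_above:
  fixes f g :: "'a::euclidean_space \<Rightarrow> 'a"
  assumes "\<alpha> \<ge> 0" "f \<in> D1 L \<alpha>" "g \<in> D1 L \<alpha>"
  shows "bdd_above ((\<lambda>x. norm (f x - g x) +
    norm (deriv_on (cball 0 1) f x - deriv_on (cball 0 1) g x)) ` cball 0 1)"
proof -
  have val: "norm (h x) \<le> 1" if "h \<in> D1 L \<alpha>" "x \<in> cball 0 1" for h :: "'a \<Rightarrow> 'a" and x
  proof -
    have "h x \<in> ball 0 1" using that unfolding D1_def by blast
    then show ?thesis by simp
  qed
  have der: "\<exists>B. \<forall>x\<in>cball 0 1. norm (deriv_on (cball 0 1) h x) \<le> B"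
    if h: "h \<in> D1 L \<alpha>" for h :: "'a \<Rightarrow> 'a"
  proof -
    obtain C where C: "hoelder_deriv_with \<alpha> C (cball 0 1) h"
      using h unfolding D1_def by blast
    have "norm (deriv_on (cball 0 1) h x) \<le> norm (deriv_on (cball 0 1) h 0) + \<bar>C\<bar>"
      if x: "x \<in> cball 0 1" for x
    proof -
      have "norm (deriv_on (cball 0 1) h x - deriv_on (cball 0 1) h 0) \<le> C * norm (x - 0) powr \<alpha>"
        using C x unfolding hoelder_deriv_with_def by (meson centre_in_cball zero_le_one)
      also have "\<dots> \<le> \<bar>C\<bar> * 1"
        using x \<open>\<alpha> \<ge> 0\<close> powr_mono2[of \<alpha> "norm x" 1] by (intro mult_mono) auto
      finally show ?thesis
        using norm_triangle_ineq2[of "deriv_on (cball 0 1) h x" "deriv_on (cball 0 1) h 0"] by simp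
    qed
    then show ?thesis by blast
  qed
  obtain Bf where Bf: "\<forall>x\<in>cball 0 1. norm (deriv_on (cball 0 1) f x) \<le> Bf"
    using der assms(2) by blast
  obtain Bg where Bg: "\<forall>x\<in>cball 0 1. norm (deriv_on (cball 0 1) g x) \<le> Bg"
    using der assms(3) by blast
  show ?thesis
  proof (rule bdd_aboveI2)
    fix x :: 'a assume x: "x \<in> cball 0 1"
    have "norm (f x - g x) \<le> 1 + 1"
      using val[OF assms(2) x] val[OF assms(3) x] norm_triangle_ineq4[of "f x" "g x"] by linarith
    moreover have "norm (deriv_on (cball 0 1) f x - deriv_on (cball 0 1) g x) \<le> Bf + Bg"
      using bspec[OF Bf x] bspec[OF Bg x]
        norm_triangle_ineq4[of "deriv_on (cball 0 1) f x" "deriv_on (cball 0 1) g x"] by linarith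
    ultimately show "norm (f x - g x) + norm (deriv_on (cball 0 1) f x - deriv_on (cball 0 1) g x)
        \<le> 1 + 1 + (Bf + Bg)" by (rule add_mono)
  qed
qed

lemma Metric_space_D1:
  assumes "\<alpha> \<ge> 0"
  shows "Metric_space (D1 L \<alpha> :: ('a::euclidean_space \<Rightarrow> 'a) set) (D1_dist L \<alpha>)"
proof -
  let ?D = "deriv_on (cball 0 1)"
  have upper: "norm (f x - g x) + norm (?D f x - ?D g x) \<le> C1_dist f g"
    if "f \<in> D1 L \<alpha>" "g \<in> D1 L \<alpha>" "x \<in> cball 0 1" for f g :: "'a \<Rightarrow> 'a" and x
    unfolding C1_dist_def using that D1_bdd_above[OF assms] by (intro cSUP_upper) auto
  have C1_nonneg: "0 \<le> C1_dist f g" if "f \<in> D1 L \<alpha>" "g \<in> D1 L \<alpha>" for f g :: "'a \<Rightarrow> 'a"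
    using upper[OF that, of 0]
    by (smt (verit) centre_in_cball norm_ge_zero)
  show ?thesis
  proof
    fix f g :: "'a \<Rightarrow> 'a"
    show "0 \<le> D1_dist L \<alpha> f g" by (simp add: D1_dist_def C1_nonneg)
    show "D1_dist L \<alpha> f g = D1_dist L \<alpha> g f"
      by (auto simp: D1_dist_def C1_dist_def norm_minus_commute)
  next
    fix f g :: "'a \<Rightarrow> 'a" assume fg: "f \<in> D1 L \<alpha>" "g \<in> D1 L \<alpha>"
    show "D1_dist L \<alpha> f g = 0 \<longleftrightarrow> f = g"
    proof
      assume "D1_dist L \<alpha> f g = 0"
      then have 0: "C1_dist f g = 0" using fg by (simp add: D1_dist_def)
      show "f = g"
      proof (rule extensionalityI[where A = "cball 0 1"])
        show "f \<in> extensional (cball 0 1)" "g \<in> extensional (cball 0 1)"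
          using fg unfolding D1_def by auto
        fix x :: 'a assume "x \<in> cball 0 1"
        from upper[OF fg this] have "norm (f x - g x) + norm (?D f x - ?D g x) \<le> 0"
          using 0 by simp
        then have "norm (f x - g x) \<le> 0"
          using norm_ge_zero[of "?D f x - ?D g x"] by linarith
        then show "f x = g x" by simp
      qed
    next
      assume "f = g" then show "D1_dist L \<alpha> f g = 0" by (simp add: D1_dist_def C1_dist_def)
    qed
  next
    fix f g h :: "'a \<Rightarrow> 'a"
    assume fgh: "f \<in> D1 L \<alpha>" "g \<in> D1 L \<alpha>" "h \<in> D1 L \<alpha>"
    have "C1_dist f h \<le> C1_dist f g + C1_dist g h"
      unfolding C1_dist_def[of f h]
    proof (rule cSUP_least)
      fix x :: 'a assume x: "x \<in> cball 0 1"
      have "norm (f x - h x) \<le> norm (f x - g x) + norm (g x - h x)"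
        using norm_triangle_ineq[of "f x - g x" "g x - h x"] by simp
      moreover have "norm (?D f x - ?D h x) \<le> norm (?D f x - ?D g x) + norm (?D g x - ?D h x)"
        using norm_triangle_ineq[of "?D f x - ?D g x" "?D g x - ?D h x"] by simp
      ultimately show "norm (f x - h x) + norm (?D f x - ?D h x) \<le> C1_dist f g + C1_dist g h"
        using upper[OF fgh(1,2) x] upper[OF fgh(2,3) x] by linarith
    qed simp
    then show "D1_dist L \<alpha> f h \<le> D1_dist L \<alpha> f g + D1_dist L \<alpha> g h"
      using fgh by (simp add: D1_dist_def)
  qed
qed


section \<open>Differentiable iterated function systems\<close>

text \<open>A system is represented by its generating set of maps.\<close>

definition DIFS :: "real \<Rightarrow> real \<Rightarrow> ('a::euclidean_space \<Rightarrow> 'a) set set"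
  where "DIFS L \<alpha> =
    {F. F \<noteq> {} \<and> compactin (C1_topology L \<alpha>) F \<and>
        (\<exists>C. \<forall>f\<in>F. hoelder_deriv_with \<alpha> C (cball 0 1) f)}"

definition hyperspace :: "'a::euclidean_space set set"
  where "hyperspace = {A. A \<noteq> {} \<and> compact A \<and> A \<subseteq> cball 0 1}"

definition ifs_map :: "('a \<Rightarrow> 'a) set \<Rightarrow> 'a set \<Rightarrow> 'a set"
  where "ifs_map F A = (\<Union>x\<in>A. \<Union>f\<in>F. {f x})"

definition limit_set :: "('a::euclidean_space \<Rightarrow> 'a) set \<Rightarrow> 'a set"
  where "limit_set F = (THE A. A \<in> hyperspace \<and> ifs_map F A = A)"

text \<open>
  For \<open>fs = [f\<^sub>1, \<dots>, f\<^sub>n]\<close> the term \<open>fold (\<circ>) fs id\<close> is \<open>f\<^sub>n \<circ> \<dots> \<circ> f\<^sub>1\<close>. The maps send the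
  closed ball into itself, so their values off the ball play no role in the derivative. The
  maximum is written as a supremum; for members of \<^const>\<open>DIFS\<close> it is attained by compactness.
\<close>

definition semi_conformal :: "real \<Rightarrow> real \<Rightarrow> ('a::euclidean_space \<Rightarrow> 'a) set set"
  where "semi_conformal L \<alpha> =
    {F \<in> DIFS L \<alpha>.
      (\<lambda>n. SUP (fs, x) \<in> {fs. length fs = n \<and> set fs \<subseteq> F} \<times> cball 0 1.
         (let A = blinfun_apply (deriv_on (cball 0 1) (fold (\<circ>) fs id) x)
          in 1 / real n * ln (onorm A * onorm (inv A)))) \<longlonglongrightarrow> 0}"


section \<open>Fractal dimensions\<close>

text \<open>
  Countable covers are sequences of sets, possibly empty. Boundedness is required explicitly
  because \<^const>\<open>diameter\<close> is unspecified on unbounded sets.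
\<close>

definition hausdorff_premeasure :: "real \<Rightarrow> real \<Rightarrow> 'a::metric_space set \<Rightarrow> ennreal"
  where "hausdorff_premeasure s \<delta> A =
    (INF U \<in> {U :: nat \<Rightarrow> 'a set. A \<subseteq> (\<Union>i. U i) \<and> (\<forall>i. bounded (U i) \<and> diameter (U i) \<le> \<delta>)}.
       \<Sum>i. ennreal (diameter (U i) powr s))"

definition hausdorff_outer_measure :: "real \<Rightarrow> 'a::metric_space set \<Rightarrow> ennreal"
  where "hausdorff_outer_measure s A = (SUP \<delta>\<in>{0<..}. hausdorff_premeasure s \<delta> A)"

text \<open>
  Only exponents \<open>s > 0\<close> are used, which leaves the infimum unchanged and avoids the convention
  \<open>0 powr 0 = 0\<close>.
\<close>

definition hausdorff_dim :: "'a::metric_space set \<Rightarrow> ereal"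
  where "hausdorff_dim A = Inf {ereal s |s. s > 0 \<and> hausdorff_outer_measure s A = 0}"

definition covering_number :: "'a::metric_space set \<Rightarrow> real \<Rightarrow> nat"
  where "covering_number C \<delta> =
    (LEAST n. \<exists>X. finite X \<and> card X = n \<and> C \<subseteq> (\<Union>x\<in>X. ball x \<delta>))"

definition limit_capacity :: "'a::metric_space set \<Rightarrow> ereal"
  where "limit_capacity C =
    Limsup (at_right 0) (\<lambda>\<delta>. ereal (ln (real (covering_number C \<delta>)) / (- ln \<delta>)))"

end

theory Submission
  imports Defs
begin

text \<open>
  Every compact set \<open>K\<close> satisfies \<open>dim\<^sub>H K \<le> d\<^sub>c K\<close>, because efficient covers by balls of one
  radius are covers. The converse inequality fails in general. It holds for the limit set \<open>\<Lambda>\<close>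
  because \<open>\<Lambda>\<close> is almost self-similar: for every \<open>a > 0\<close> there is \<open>c > 0\<close> such that each ball of
  radius \<open>\<delta> < 1\<close> about a point of \<open>\<Lambda>\<close> contains a copy of the whole of \<open>\<Lambda>\<close>, the image of \<open>\<Lambda>\<close> under
  a map that shrinks distances at most by the factor \<open>c \<delta>\<^bsup>1+a\<^esup>\<close> (lemma \<open>expanding_copies\<close>).
  Overlaps between the images of the maps do no harm, because separation is produced at a
  single scale: if \<open>s < d\<^sub>c \<Lambda>\<close>, then for some small \<open>\<delta>\<close> there are
  more than \<open>\<delta>\<^bsup>-s\<^esup>\<close> points of \<open>\<Lambda>\<close> with mutual distance at least \<open>\<delta>\<close>. Copies of \<open>\<Lambda>\<close> in the balls of
  radius \<open>\<delta>/3\<close> about them are disjoint, and iterating the corresponding maps yields a Cantor-like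
  subset whose dimension is at least about \<open>s/(1+a)\<close>. This idea, due to Falconer, is carried by
  \<open>separated_expansion_outer_measure\<close> and \<open>limit_capacity_le_hausdorff_dim\<close>.
  
  The copies are images of \<open>\<Lambda>\<close> under compositions \<open>W = f\<^sub>n \<circ> \<dots> \<circ> f\<^sub>1\<close>, where the word is stopped
  as soon as the image of the unit ball has diameter at most \<open>\<delta>\<close>. Two facts control such a \<open>W\<close>.
  First, semi-conformality bounds the condition number of \<open>DW\<close> at every point by \<open>T e\<^bsup>\<epsilon>n\<^esup>\<close>, which is a
  negligible power of \<open>1/\<delta>\<close> (\<open>semi_conformal_condition\<close>). Second, \<open>W\<close> is close to its linearization:
  the vector \<open>v\<close> with \<open>DW(y) v = W x - W y\<close> differs little from \<open>x - y\<close>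
  (\<open>pulled_back_difference\<close>). Indeed, composing with one more map changes \<open>v\<close> by the Taylor error
  of that map, of relative size \<open>L\<^bsup>n\<alpha>\<^esup>\<close> by Hoelder continuity of the derivatives, pulled
  back by a linear map of condition number at most \<open>T e\<^bsup>\<epsilon>n\<^esup>\<close>; for small \<open>\<epsilon>\<close> these changes
  are summable. A diameter of about \<open>\<delta>\<close> therefore forces \<open>\<parallel>DW\<parallel>\<close> to be about \<open>\<delta>\<close>, the
  condition number transfers this to all directions, and the linearization to all pairs of
  nearby points. One fixed word, applied before \<open>W\<close>, makes all points of \<open>\<Lambda>\<close> nearby.
\<close>

section \<open>Hausdorff dimension and limit capacity\<close>

lemma covering_number_witness:
  fixes K :: "'a::metric_space set"
  assumes K: "compact K" and "0 < \<delta>"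
  obtains X where "finite X" "card X = covering_number K \<delta>" "K \<subseteq> (\<Union>x\<in>X. ball x \<delta>)"
proof -
  have "\<exists>n X. finite X \<and> card X = n \<and> K \<subseteq> (\<Union>x\<in>X. ball x \<delta>)"
    using K \<open>0 < \<delta>\<close> by (metis compact_eq_totally_bounded)
  from LeastI_ex[OF this] show ?thesis
    using that unfolding covering_number_def by metis
qed

lemma covering_number_pos:
  fixes K :: "'a::metric_space set"
  assumes "compact K" "K \<noteq> {}" "0 < \<delta>"
  shows "1 \<le> covering_number K \<delta>"
proof -
  obtain X where "finite X" "card X = covering_number K \<delta>" "K \<subseteq> (\<Union>x\<in>X. ball x \<delta>)"
    using covering_number_witness assms by blast
  then show ?thesis using assms(2) by (cases "X = {}") (auto simp: Suc_le_eq card_gt_0_iff)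
qed

lemma covering_number_le:
  assumes "finite X" "K \<subseteq> (\<Union>x\<in>X. ball x \<delta>)"
  shows "covering_number K \<delta> \<le> card X"
  unfolding covering_number_def using assms by (intro Least_le) auto

lemma limit_capacity_nonneg:
  fixes K :: "'a::metric_space set"
  assumes K: "compact K" "K \<noteq> {}"
  shows "0 \<le> limit_capacity K"
proof -
  have "\<forall>\<^sub>F \<delta> in at_right (0::real). \<delta> < 1 \<and> 0 < \<delta>"
    by (auto simp: eventually_at_right_field intro: exI[of _ 1])
  then have "\<forall>\<^sub>F \<delta> in at_right 0. (0::ereal) \<le> ereal (ln (real (covering_number K \<delta>)) / (- ln \<delta>))"
  proof (rule eventually_mono)
    fix \<delta> :: real assume "\<delta> < 1 \<and> 0 < \<delta>"
    moreover then have "1 \<le> covering_number K \<delta>" using covering_number_pos K by blast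
    ultimately have "0 \<le> ln (real (covering_number K \<delta>))" "0 \<le> - ln \<delta>" by auto
    then show "(0::ereal) \<le> ereal (ln (real (covering_number K \<delta>)) / (- ln \<delta>))"
      by (metis divide_nonneg_nonneg ereal_less_eq(5))
  qed
  then have "Liminf (at_right 0) (\<lambda>\<delta>. ereal (ln (real (covering_number K \<delta>)) / (- ln \<delta>))) \<ge> 0"
    by (rule Liminf_bounded)
  also have "Liminf (at_right 0) (\<lambda>\<delta>. ereal (ln (real (covering_number K \<delta>)) / (- ln \<delta>))) \<le> limit_capacity K"
    unfolding limit_capacity_def by (intro Liminf_le_Limsup) auto
  finally show ?thesis .
qed

lemma hausdorff_premeasure_le_covering_number:
  fixes K :: "'a::metric_space set"
  assumes K: "compact K" and \<delta>: "0 < \<delta>" and s: "0 < s"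
  shows "hausdorff_premeasure s (2 * \<delta>) K \<le> ennreal (real (covering_number K \<delta>) * (2 * \<delta>) powr s)"
proof -
  obtain X where X: "finite X" "card X = covering_number K \<delta>" "K \<subseteq> (\<Union>x\<in>X. ball x \<delta>)"
    using covering_number_witness K \<delta> by blast
  obtain h where h: "bij_betw h {..<card X} X"
    using ex_bij_betw_nat_finite[OF X(1)] by (auto simp: lessThan_atLeast0)
  define U where "U i = (if i < card X then ball (h i) \<delta> else {})" for i
  have diam: "diameter (U i) \<le> (if i < card X then 2 * \<delta> else 0)" for i
  proof -
    have "dist x y \<le> 2 * \<delta>" if "x \<in> ball (h i) \<delta>" "y \<in> ball (h i) \<delta>" for x y
      using that dist_triangle2[of x y "h i"] by (auto simp: dist_commute)
    then have "diameter (ball (h i) \<delta>) \<le> 2 * \<delta>"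
      using \<delta> unfolding diameter_def by (auto intro!: cSUP_least)
    then show ?thesis by (auto simp: U_def)
  qed
  have "K \<subseteq> (\<Union>i. U i)"
  proof
    fix x assume "x \<in> K"
    then obtain y where "y \<in> X" "x \<in> ball y \<delta>" using X by blast
    moreover then obtain i where "i < card X" "h i = y"
      using bij_betw_imp_surj_on[OF h] by (metis imageE lessThan_iff)
    ultimately have "x \<in> U i" by (auto simp: U_def)
    then show "x \<in> (\<Union>i. U i)" by blast
  qed
  moreover have "bounded (U i) \<and> diameter (U i) \<le> 2 * \<delta>" for i
    using diam[of i] \<delta> by (auto simp: U_def split: if_splits)
  ultimately have "hausdorff_premeasure s (2 * \<delta>) K \<le> (\<Sum>i. ennreal (diameter (U i) powr s))"
    unfolding hausdorff_premeasure_def by (intro INF_lower) auto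
  also have "\<dots> = (\<Sum>i<card X. ennreal (diameter (U i) powr s))"
    by (intro suminf_finite) (auto simp: U_def)
  also have "\<dots> \<le> (\<Sum>i<card X. ennreal ((2 * \<delta>) powr s))"
  proof (intro sum_mono ennreal_leI powr_mono2)
    fix i assume "i \<in> {..<card X}"
    then show "diameter (U i) \<le> 2 * \<delta>" using diam[of i] by auto
    show "0 \<le> diameter (U i)" by (intro diameter_ge_0) (auto simp: U_def)
  qed (use s in auto)
  also have "\<dots> = ennreal (real (covering_number K \<delta>) * (2 * \<delta>) powr s)"
    by (simp add: X(2) ennreal_mult'' ennreal_of_nat_eq_real_of_nat)
  finally show ?thesis .
qed

lemma hausdorff_premeasure_antimono:
  assumes "\<delta> \<le> \<delta>'"
  shows "hausdorff_premeasure s \<delta>' A \<le> hausdorff_premeasure s \<delta> A"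
  unfolding hausdorff_premeasure_def using assms by (intro INF_superset_mono) (auto intro: order_trans)

lemma hausdorff_dim_le_limit_capacity:
  fixes K :: "'a::metric_space set"
  assumes K: "compact K" "K \<noteq> {}"
  shows "hausdorff_dim K \<le> limit_capacity K"
proof (rule ccontr)
  assume "\<not> ?thesis"
  then have "limit_capacity K < hausdorff_dim K" by simp
  from ereal_dense2[OF this] obtain s
    where s: "limit_capacity K < ereal s" "ereal s < hausdorff_dim K" by metis
  from ereal_dense2[OF s(1)] obtain s'
    where s': "limit_capacity K < ereal s'" "s' < s" by (metis less_ereal.simps(1))
  have "0 < ereal s'" using limit_capacity_nonneg[OF K] s'(1) by (rule order.strict_trans1)
  then have "0 < s'" by simp
  then have "0 < s" using s' by simp
  have "\<forall>\<^sub>F \<delta> in at_right 0. ereal (ln (real (covering_number K \<delta>)) / (- ln \<delta>)) < ereal s'"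
    using s'(1) unfolding limit_capacity_def by (rule Limsup_lessD)
  moreover have "\<forall>\<^sub>F \<delta> in at_right (0::real). \<delta> < 1 \<and> 0 < \<delta>"
    by (auto simp: eventually_at_right_field intro: exI[of _ 1])
  ultimately have ev: "\<forall>\<^sub>F \<delta> in at_right 0.
      hausdorff_premeasure s (2 * \<delta>) K \<le> ennreal (2 powr s * \<delta> powr (s - s')) \<and> 0 < \<delta>"
  proof eventually_elim
    fix \<delta> :: real
    assume less: "ereal (ln (real (covering_number K \<delta>)) / (- ln \<delta>)) < ereal s'" and \<delta>: "\<delta> < 1 \<and> 0 < \<delta>"
    have N: "1 \<le> real (covering_number K \<delta>)" using covering_number_pos[OF K, of \<delta>] \<delta> by simp
    have "ln (real (covering_number K \<delta>)) \<le> - s' * ln \<delta>"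
      using less \<delta> by (simp add: field_simps)
    then have "real (covering_number K \<delta>) \<le> \<delta> powr (- s')"
      using N \<delta> by (simp add: powr_def ln_ge_iff flip: ln_le_cancel_iff)
    then have "real (covering_number K \<delta>) * (2 * \<delta>) powr s \<le> \<delta> powr (- s') * (2 * \<delta>) powr s"
      by (intro mult_right_mono) auto
    also have "\<dots> = 2 powr s * \<delta> powr (s - s')"
      using \<delta> by (simp add: powr_mult powr_diff powr_minus field_simps)
    finally show "hausdorff_premeasure s (2 * \<delta>) K \<le> ennreal (2 powr s * \<delta> powr (s - s')) \<and> 0 < \<delta>"
      using hausdorff_premeasure_le_covering_number[OF K(1), of \<delta> s] \<delta> \<open>0 < s\<close>
      by (auto intro: order_trans ennreal_leI)
  qed
  have lim: "((\<lambda>\<delta>. ennreal (2 powr s * \<delta> powr (s - s'))) \<longlongrightarrow> ennreal (2 powr s * 0)) (at_right 0)"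
  proof (intro tendsto_ennrealI tendsto_intros)
    show "((\<lambda>\<delta>. \<delta> powr (s - s')) \<longlongrightarrow> 0) (at_right 0)"
      using s' by (intro tendsto_zero_powrI[where b = "s - s'"]) (auto simp: eventually_at_filter)
  qed
  have "hausdorff_premeasure s e K = 0" if "0 < e" for e
  proof -
    have "\<forall>\<^sub>F \<delta> in at_right 0. \<delta> < e / 2 \<and> 0 < \<delta>"
      using that by (auto simp: eventually_at_right_field intro: exI[of _ "e / 2"])
    with ev have "\<forall>\<^sub>F \<delta> in at_right 0.
        hausdorff_premeasure s e K \<le> ennreal (2 powr s * \<delta> powr (s - s'))"
    proof eventually_elim
      fix \<delta> assume a: "hausdorff_premeasure s (2 * \<delta>) K \<le> ennreal (2 powr s * \<delta> powr (s - s')) \<and> 0 < \<delta>"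
        and b: "\<delta> < e / 2 \<and> 0 < \<delta>"
      have "hausdorff_premeasure s e K \<le> hausdorff_premeasure s (2 * \<delta>) K"
        using b by (intro hausdorff_premeasure_antimono) auto
      then show "hausdorff_premeasure s e K \<le> ennreal (2 powr s * \<delta> powr (s - s'))"
        using a by auto
    qed
    then have "hausdorff_premeasure s e K \<le> ennreal (2 powr s * 0)"
      by (intro tendsto_lowerbound[OF lim]) auto
    then show ?thesis by simp
  qed
  then have "hausdorff_outer_measure s K = 0"
    by (auto simp: hausdorff_outer_measure_def intro!: SUP_eq_const)
  then have "hausdorff_dim K \<le> ereal s"
    unfolding hausdorff_dim_def using \<open>0 < s\<close> by (intro Inf_lower) auto
  then show False using s(2) by simp
qed

text \<open>
  The images of \<open>K\<close> under \<open>k\<close>-fold compositions of the \<open>\<phi> j\<close> form a tree of nested compact sets in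
  which two children of a set of level \<open>k\<close> are at distance at least \<open>d * r ^ k\<close>. Suppose
  that the weights \<open>diameter (U i) powr t\<close> of a cover have a sum below \<open>d powr t\<close>. By induction
  there is a branch whose set of level \<open>k\<close> only meets members of the cover of total weight less than
  \<open>(d * r ^ k) powr t\<close>: each of these members is too small to meet two children, so their weight is
  distributed among the children, and by the pigeonhole principle some child gets at most the
  fraction \<open>1 / card J \<le> r powr t\<close> of it. The point at the end of the branch lies in a member of the
  cover whose weight is then smaller than every \<open>(d * r ^ k) powr t\<close>, hence zero. The
  selection of a branch replaces the usual mass distribution on the Cantor set.
\<close>

lemma separated_expansion_outer_measure:
  fixes K :: "'a::heine_borel set" and \<phi> :: "'j \<Rightarrow> 'a \<Rightarrow> 'a"
  assumes K: "compact K" "K \<noteq> {}" and J: "finite J"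
    and cont: "\<And>j. j \<in> J \<Longrightarrow> continuous_on K (\<phi> j)"
    and into: "\<And>j. j \<in> J \<Longrightarrow> \<phi> j ` K \<subseteq> K"
    and expand: "\<And>j u v. j \<in> J \<Longrightarrow> u \<in> K \<Longrightarrow> v \<in> K \<Longrightarrow> r * dist u v \<le> dist (\<phi> j u) (\<phi> j v)"
    and sep: "\<And>i j u v. i \<in> J \<Longrightarrow> j \<in> J \<Longrightarrow> i \<noteq> j \<Longrightarrow> u \<in> K \<Longrightarrow> v \<in> K \<Longrightarrow> d \<le> dist (\<phi> i u) (\<phi> j v)"
    and r: "0 < r" "r < 1" and d: "0 < d" and t: "0 < t"
    and many: "1 \<le> real (card J) * r powr t"
    and cover: "K \<subseteq> (\<Union>i. U i)" and bdd: "\<And>i::nat. bounded (U i)"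
  shows "ennreal (d powr t) \<le> (\<Sum>i. ennreal (diameter (U i) powr t))"
proof (rule ccontr)
  assume "\<not> ?thesis"
  then have less: "(\<Sum>i. ennreal (diameter (U i) powr t)) < ennreal (d powr t)" by simp
  then obtain s where s: "0 \<le> s" "(\<Sum>i. ennreal (diameter (U i) powr t)) = ennreal s"
    by (metis enn2real_nonneg ennreal_enn2real_if ennreal_less_top less_trans order_less_irrefl)
  \<comment> \<open>Members of diameter \<open>0\<close> would have weight \<open>0\<close> and give no contradiction at the end of the
    branch. Half of the gap is spent on making all weights positive.\<close>
  define \<eta> where "\<eta> = (d powr t - s) / 2"
  have \<eta>: "0 < \<eta>" "s + \<eta> < d powr t"
    using less s by (auto simp: \<eta>_def ennreal_less_iff field_simps)
  define c where "c i = diameter (U i) powr t + \<eta> * (1/2) ^ Suc i" for i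
  have c: "diameter (U i) powr t < c i" "0 < c i" for i
    using \<eta> by (auto simp: c_def add_nonneg_pos)
  define w where "w i = ennreal (c i)" for i
  define T where "T A = (\<Sum>i. if U i \<inter> A \<noteq> {} then w i else 0)" for A
  have w_pos: "0 < w i" for i
    using c by (simp add: w_def)
  have "(\<Sum>i. w i) = (\<Sum>i. ennreal (diameter (U i) powr t)) + (\<Sum>i. ennreal (\<eta> * (1/2) ^ Suc i))"
    unfolding w_def c_def using \<eta> by (subst suminf_add) (auto intro!: suminf_cong ennreal_plus)
  also have "(\<Sum>i. ennreal (\<eta> * (1/2) ^ Suc i)) = ennreal \<eta>"
    using sums_mult[OF power_half_series, of \<eta>] \<eta>
    by (intro suminf_ennreal_eq) auto
  finally have "(\<Sum>i. w i) = ennreal (s + \<eta>)" using s \<eta> by simp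
  then have total: "(\<Sum>i. w i) < ennreal (d powr t)" using \<eta> s by (metis add_nonneg_nonneg ennreal_lessI less_imp_le
      order.strict_trans1)
  define Q where "Q k \<psi> \<longleftrightarrow> continuous_on K \<psi> \<and> \<psi> ` K \<subseteq> K \<and>
      (\<forall>u\<in>K. \<forall>v\<in>K. r ^ k * dist u v \<le> dist (\<psi> u) (\<psi> v)) \<and>
      T (\<psi> ` K) < ennreal ((d * r ^ k) powr t)" for k and \<psi> :: "'a \<Rightarrow> 'a"
  have "\<exists>\<psi>. \<forall>k. Q k (\<psi> k) \<and> \<psi> (Suc k) ` K \<subseteq> \<psi> k ` K"
  proof (rule dependent_nat_choice)
    have "T (id ` K) \<le> (\<Sum>i. w i)" unfolding T_def by (intro suminf_le) auto
    then show "\<exists>x. Q 0 x"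
      using total by (intro exI[of _ id]) (auto simp: Q_def)
  next
    fix \<psi> k assume Q: "Q k \<psi>"
    have small: "diameter (U i) < d * r ^ k" if "U i \<inter> \<psi> ` K \<noteq> {}" for i
    proof -
      have "w i \<le> T (\<psi> ` K)"
        unfolding T_def using that sum_le_suminf[of "\<lambda>i. if U i \<inter> \<psi> ` K \<noteq> {} then w i else 0" "{i}"] by simp
      then have "w i < ennreal ((d * r ^ k) powr t)" using Q by (auto simp: Q_def)
      then have "c i < (d * r ^ k) powr t"
        using c(2)[of i] by (simp add: w_def ennreal_less_iff)
      then have "diameter (U i) powr t < (d * r ^ k) powr t"
        using c(1)[of i] by simp
      then show ?thesis
        using t d r powr_mono2[of t "d * r ^ k" "diameter (U i)"] by (force simp: not_less)
    qed
    have one: "i = j" if ij: "i \<in> J" "j \<in> J" and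
      ne: "U l \<inter> \<psi> ` \<phi> i ` K \<noteq> {}" "U l \<inter> \<psi> ` \<phi> j ` K \<noteq> {}" for i j l
    proof (rule ccontr)
      assume "i \<noteq> j"
      obtain u v where uv: "u \<in> K" "\<psi> (\<phi> i u) \<in> U l" "v \<in> K" "\<psi> (\<phi> j v) \<in> U l"
        using ne by blast
      have in_K: "\<phi> i u \<in> K" "\<phi> j v \<in> K" using uv ij into by auto
      have "r ^ k * d \<le> r ^ k * dist (\<phi> i u) (\<phi> j v)"
        using sep[OF ij \<open>i \<noteq> j\<close>] uv r by (intro mult_left_mono) auto
      also have "\<dots> \<le> dist (\<psi> (\<phi> i u)) (\<psi> (\<phi> j v))" using Q in_K by (auto simp: Q_def)
      also have "\<dots> \<le> diameter (U l)" using uv bdd by (intro diameter_bounded_bound) auto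
      also have "\<dots> < d * r ^ k" using small[of l] uv in_K by blast
      finally show False by (simp add: mult.commute)
    qed
    have "(\<Sum>j\<in>J. T (\<psi> ` \<phi> j ` K)) = (\<Sum>l. \<Sum>j\<in>J. if U l \<inter> \<psi> ` \<phi> j ` K \<noteq> {} then w l else 0)"
      unfolding T_def by (subst suminf_sum) auto
    also have "\<dots> \<le> T (\<psi> ` K)"
      unfolding T_def
    proof (intro suminf_le allI)
      fix l
      show "(\<Sum>j\<in>J. if U l \<inter> \<psi> ` \<phi> j ` K \<noteq> {} then w l else 0)
          \<le> (if U l \<inter> \<psi> ` K \<noteq> {} then w l else 0)"
      proof (cases "\<exists>i\<in>J. U l \<inter> \<psi> ` \<phi> i ` K \<noteq> {}")
        case True
        then obtain i where i: "i \<in> J" "U l \<inter> \<psi> ` \<phi> i ` K \<noteq> {}" by blast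
        have "(\<Sum>j\<in>J. if U l \<inter> \<psi> ` \<phi> j ` K \<noteq> {} then w l else 0) = (\<Sum>j\<in>J. if j = i then w l else 0)"
        proof (intro sum.cong refl)
          fix j assume "j \<in> J"
          then show "(if U l \<inter> \<psi> ` \<phi> j ` K \<noteq> {} then w l else 0) = (if j = i then w l else 0)"
            using one[OF _ i(1) _ i(2), of j] i(2) by (cases "j = i") auto
        qed
        also have "\<dots> = w l" using J i by simp
        finally have "(\<Sum>j\<in>J. if U l \<inter> \<psi> ` \<phi> j ` K \<noteq> {} then w l else 0) = w l" .
        moreover have "U l \<inter> \<psi> ` K \<noteq> {}" using i(2) into[OF i(1)] by blast
        ultimately show ?thesis by simp
      next
        case False
        then show ?thesis by (simp add: sum.neutral)
      qed
    qed auto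
    also have "\<dots> < ennreal ((d * r ^ k) powr t)" using Q by (simp add: Q_def)
    finally have sum_less: "(\<Sum>j\<in>J. T (\<psi> ` \<phi> j ` K)) < ennreal ((d * r ^ k) powr t)" .
    have "\<exists>j\<in>J. T (\<psi> ` \<phi> j ` K) < ennreal ((d * r ^ Suc k) powr t)"
    proof (rule ccontr)
      assume "\<not> ?thesis"
      then have "(\<Sum>j\<in>J. ennreal ((d * r ^ Suc k) powr t)) \<le> (\<Sum>j\<in>J. T (\<psi> ` \<phi> j ` K))"
        by (intro sum_mono) (auto simp: not_less)
      moreover have "(\<Sum>j\<in>J. ennreal ((d * r ^ Suc k) powr t))
          = ennreal (real (card J) * (d * r ^ Suc k) powr t)"
        by (simp add: ennreal_mult'' ennreal_of_nat_eq_real_of_nat)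
      moreover have "(d * r ^ k) powr t \<le> real (card J) * (d * r ^ Suc k) powr t"
      proof -
        have "(d * r ^ k) powr t * 1 \<le> (d * r ^ k) powr t * (real (card J) * r powr t)"
          by (intro mult_left_mono many) auto
        then show ?thesis using r d by (simp add: powr_mult mult_ac)
      qed
      ultimately show False
        using sum_less by (metis ennreal_leI leD order_trans)
    qed
    then obtain j where j: "j \<in> J" "T (\<psi> ` \<phi> j ` K) < ennreal ((d * r ^ Suc k) powr t)" by blast
    have "r ^ Suc k * dist u v \<le> dist (\<psi> (\<phi> j u)) (\<psi> (\<phi> j v))" if "u \<in> K" "v \<in> K" for u v
    proof -
      have "r ^ k * (r * dist u v) \<le> r ^ k * dist (\<phi> j u) (\<phi> j v)"
        using expand[OF j(1) that] r by (intro mult_left_mono) auto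
      also have "\<dots> \<le> dist (\<psi> (\<phi> j u)) (\<psi> (\<phi> j v))"
        using Q subsetD[OF into[OF j(1)] imageI[OF that(1)]] subsetD[OF into[OF j(1)] imageI[OF that(2)]]
        unfolding Q_def by blast
      finally show ?thesis by (simp add: mult_ac)
    qed
    moreover have "continuous_on K (\<psi> \<circ> \<phi> j)"
      using Q cont[OF j(1)] into[OF j(1)] unfolding Q_def
      by (intro continuous_on_compose) (auto intro: continuous_on_subset)
    moreover have "(\<psi> \<circ> \<phi> j) ` K \<subseteq> \<psi> ` K" using into[OF j(1)] by auto
    moreover have "(\<psi> \<circ> \<phi> j) ` K \<subseteq> K"
      using calculation(3) Q unfolding Q_def by (meson order_trans)
    ultimately show "\<exists>\<psi>'. Q (Suc k) \<psi>' \<and> \<psi>' ` K \<subseteq> \<psi> ` K"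
      using Q j by (intro exI[of _ "\<psi> \<circ> \<phi> j"]) (auto simp: Q_def image_comp)
  qed
  then obtain \<psi> where \<psi>: "\<And>k. Q k (\<psi> k)" "\<And>k. \<psi> (Suc k) ` K \<subseteq> \<psi> k ` K" by blast
  have "(\<Inter>k. \<psi> k ` K) \<noteq> {}"
  proof (rule compact_nest)
    show "compact (\<psi> n ` K)" for n using \<psi>(1)[of n] K by (auto simp: Q_def intro: compact_continuous_image)
    show "m \<le> n \<Longrightarrow> \<psi> n ` K \<subseteq> \<psi> m ` K" for m n
      using \<psi>(2) by (rule lift_Suc_antimono_le)
  qed (use K in auto)
  then obtain x where x: "\<And>k. x \<in> \<psi> k ` K" by auto
  then have "x \<in> K" using \<psi>(1)[of 0] by (auto simp: Q_def)
  then obtain i where i: "x \<in> U i" using cover by blast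
  have "w i < ennreal ((d * r ^ k) powr t)" for k
  proof -
    have "U i \<inter> \<psi> k ` K \<noteq> {}" using i x by blast
    then have "w i \<le> T (\<psi> k ` K)"
      unfolding T_def using sum_le_suminf[of "\<lambda>i. if U i \<inter> \<psi> k ` K \<noteq> {} then w i else 0" "{i}"] by simp
    then show ?thesis using \<psi>(1)[of k] by (auto simp: Q_def)
  qed
  moreover have "(\<lambda>k. ennreal ((d * r ^ k) powr t)) \<longlonglongrightarrow> ennreal 0"
  proof (intro tendsto_ennrealI)
    have "(\<lambda>k. d * r ^ k) \<longlonglongrightarrow> d * 0" using r by (intro tendsto_intros LIMSEQ_realpow_zero) auto
    then show "(\<lambda>k. (d * r ^ k) powr t) \<longlonglongrightarrow> 0"
      using t d r by (intro tendsto_zero_powrI[where b=t]) auto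
  qed
  ultimately have "w i \<le> 0" by (intro LIMSEQ_le_const) (auto intro: less_imp_le)
  then show False using w_pos[of i] by simp
qed

text \<open>
  A \<open>\<delta>\<close>-separated subset of maximal cardinality is a net. The cardinality is bounded because
  a ball of radius \<open>\<delta>/2\<close> contains at most one point of a separated set.
\<close>

lemma ex_separated_net:
  fixes K :: "'a::metric_space set"
  assumes K: "compact K" and \<delta>: "0 < \<delta>"
  obtains X where "X \<subseteq> K" "finite X" "\<And>x y. x \<in> X \<Longrightarrow> y \<in> X \<Longrightarrow> x \<noteq> y \<Longrightarrow> \<delta> \<le> dist x y"
    "K \<subseteq> (\<Union>x\<in>X. ball x \<delta>)"
proof -
  obtain Y where Y: "finite Y" "K \<subseteq> (\<Union>y\<in>Y. ball y (\<delta> / 2))"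
    by (rule covering_number_witness[OF K half_gt_zero[OF \<delta>]])
  define P where "P X \<longleftrightarrow> X \<subseteq> K \<and> finite X \<and> (\<forall>x\<in>X. \<forall>y\<in>X. x \<noteq> y \<longrightarrow> \<delta> \<le> dist x y)" for X
  have "card X \<le> card Y" if X: "P X" for X
  proof -
    have "X \<subseteq> (\<Union>y\<in>Y. ball y (\<delta> / 2))" using X Y(2) unfolding P_def by blast
    then have "\<forall>x\<in>X. \<exists>y. y \<in> Y \<and> dist y x < \<delta> / 2" unfolding subset_iff UN_iff mem_ball by blast
    from bchoice[OF this] obtain h
      where h: "\<And>x. x \<in> X \<Longrightarrow> h x \<in> Y" "\<And>x. x \<in> X \<Longrightarrow> dist (h x) x < \<delta> / 2" by blast
    have "inj_on h X"
    proof (rule inj_onI, rule ccontr)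
      fix x y assume xy: "x \<in> X" "y \<in> X" "h x = h y" "x \<noteq> y"
      have "dist x y < \<delta>" using h(2)[OF xy(1)] h(2)[OF xy(2)] xy(3) dist_triangle3[of x y "h x"] by simp
      moreover have "\<delta> \<le> dist x y" using X xy(1,2,4) unfolding P_def by blast
      ultimately show False by simp
    qed
    then show ?thesis using h(1) Y(1) by (intro card_inj_on_le) auto
  qed
  moreover have "P {}" by (simp add: P_def)
  ultimately obtain X where X: "P X" "\<And>X'. P X' \<Longrightarrow> card X' \<le> card X"
    using ex_has_greatest_nat[of P "{}" card "Suc (card Y)"] by (auto simp: less_Suc_eq_le)
  have "K \<subseteq> (\<Union>x\<in>X. ball x \<delta>)"
  proof (rule ccontr)
    assume "\<not> ?thesis"
    then obtain z where z: "z \<in> K" "\<And>x. x \<in> X \<Longrightarrow> \<delta> \<le> dist x z"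
      unfolding subset_iff UN_iff mem_ball not_all not_imp by (meson not_le)
    then have "P (insert z X)" using X(1) by (auto simp: P_def dist_commute)
    moreover have "z \<notin> X" using z(2)[of z] \<delta> by auto
    ultimately show False using X(2)[of "insert z X"] X(1) by (simp add: P_def)
  qed
  then show ?thesis using X(1) by (intro that[of X]) (auto simp: P_def)
qed

text \<open>
  A general form of the lower bound, for a compact set that contains an almost similar copy of
  itself near each of its points at each scale. At a scale \<open>\<delta>\<close> with covering number above
  \<open>\<delta> powr (- s')\<close>, the points of a \<open>\<delta>\<close>-net carry copies that are \<open>\<delta>/3\<close>-separated and have expansion
  ratio \<open>r\<close> of order \<open>\<delta> powr (1 + a)\<close>. The excess of \<open>s'\<close> over \<open>(1 + a) * s\<close> absorbs
  the constants for small \<open>\<delta>\<close>, so that the number of copies is at least \<open>r powr (- s)\<close>.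
\<close>

lemma limit_capacity_le_hausdorff_dim:
  fixes K :: "'a::heine_borel set"
  assumes K: "compact K" "K \<noteq> {}" and a0: "0 < a0"
    and copies: "\<And>a. 0 < a \<Longrightarrow> a < a0 \<Longrightarrow> \<exists>c>0. \<forall>\<delta> x. 0 < \<delta> \<longrightarrow> \<delta> < 1 \<longrightarrow> x \<in> K \<longrightarrow>
      (\<exists>\<phi>. continuous_on K \<phi> \<and> \<phi> ` K \<subseteq> K \<inter> cball x \<delta> \<and>
        (\<forall>u\<in>K. \<forall>v\<in>K. c * \<delta> powr (1 + a) * dist u v \<le> dist (\<phi> u) (\<phi> v)))"
  shows "limit_capacity K \<le> hausdorff_dim K"
proof (rule ccontr)
  assume "\<not> ?thesis"
  then have "hausdorff_dim K < limit_capacity K" by simp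
  from ereal_dense2[OF this] obtain s
    where s: "hausdorff_dim K < ereal s" "ereal s < limit_capacity K" by metis
  from ereal_dense2[OF s(2)] obtain s'
    where s': "s < s'" "ereal s' < limit_capacity K" by (metis less_ereal.simps(1))
  obtain t where t: "0 < t" "t < s" "hausdorff_outer_measure t K = 0"
    using s(1) unfolding hausdorff_dim_def Inf_less_iff by auto
  then have "0 < s" by simp
  define a where "a = min (a0 / 2) ((s' - s) / (2 * s))"
  have a: "0 < a" "a < a0" using a0 s' \<open>0 < s\<close> by (auto simp: a_def)
  have "a * s \<le> (s' - s) / (2 * s) * s" using \<open>0 < s\<close> by (intro mult_right_mono) (auto simp: a_def)
  also have "\<dots> = (s' - s) / 2" using \<open>0 < s\<close> by simp
  also have "\<dots> < s' - s" using s' by simp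
  finally have as: "(1 + a) * s < s'" by (simp add: distrib_right)
  obtain c where c: "0 < c" and copy: "\<And>\<delta> x. 0 < \<delta> \<Longrightarrow> \<delta> < 1 \<Longrightarrow> x \<in> K \<Longrightarrow>
      \<exists>\<phi>. continuous_on K \<phi> \<and> \<phi> ` K \<subseteq> K \<inter> cball x \<delta> \<and>
        (\<forall>u\<in>K. \<forall>v\<in>K. c * \<delta> powr (1 + a) * dist u v \<le> dist (\<phi> u) (\<phi> v))"
    using copies[OF a] by blast
  define b where "b = c * (1 / 3) powr (1 + a)"
  have b: "0 < b" using c by (simp add: b_def)
  have powr_lim: "((\<lambda>\<delta>. \<delta> powr e) \<longlongrightarrow> 0) (at_right 0)" if "0 < e" for e :: real
    using that by (intro tendsto_zero_powrI[where b = e]) (auto simp: eventually_at_filter)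
  have "\<forall>\<^sub>F \<delta> in at_right 0. \<delta> powr (s' - (1 + a) * s) < b powr s"
    using powr_lim[of "s' - (1 + a) * s"] as b by (intro order_tendstoD(2)) auto
  moreover have "\<forall>\<^sub>F \<delta> in at_right 0. \<delta> powr (1 + a) < 1 / b"
    using powr_lim[of "1 + a"] a b by (intro order_tendstoD(2)) auto
  moreover have "\<forall>\<^sub>F \<delta> in at_right (0::real). \<delta> < 1 \<and> 0 < \<delta>"
    by (auto simp: eventually_at_right_field intro: exI[of _ 1])
  ultimately have ev: "\<forall>\<^sub>F \<delta> in at_right 0. \<delta> powr (s' - (1 + a) * s) < b powr s \<and>
      \<delta> powr (1 + a) < 1 / b \<and> \<delta> < 1 \<and> 0 < \<delta>"
    by eventually_elim auto
  have "\<exists>\<^sub>F \<delta> in at_right 0. ereal s' < ereal (ln (real (covering_number K \<delta>)) / (- ln \<delta>))"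
  proof (rule ccontr)
    assume "\<not> ?thesis"
    then have "\<forall>\<^sub>F \<delta> in at_right 0. ereal (ln (real (covering_number K \<delta>)) / (- ln \<delta>)) \<le> ereal s'"
      unfolding not_frequently by (simp add: not_less)
    then have "limit_capacity K \<le> ereal s'"
      unfolding limit_capacity_def by (rule Limsup_bounded)
    then show False using s'(2) by simp
  qed
  from frequently_ex[OF frequently_eventually_conj[OF this ev]] obtain \<delta>
    where less: "s' < ln (real (covering_number K \<delta>)) / (- ln \<delta>)"
      and \<delta>: "\<delta> powr (s' - (1 + a) * s) < b powr s" "\<delta> powr (1 + a) < 1 / b" "\<delta> < 1" "0 < \<delta>"
    by auto
  define r where "r = c * (\<delta> / 3) powr (1 + a)"
  have r_eq: "r = b * \<delta> powr (1 + a)" using \<delta>(4) by (simp add: r_def b_def powr_divide field_simps)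
  have r: "0 < r" "r < 1" using \<delta> b by (auto simp: r_eq field_simps)
  obtain X where X: "X \<subseteq> K" "finite X" "\<And>x y. x \<in> X \<Longrightarrow> y \<in> X \<Longrightarrow> x \<noteq> y \<Longrightarrow> \<delta> \<le> dist x y"
    "K \<subseteq> (\<Union>x\<in>X. ball x \<delta>)"
    using ex_separated_net[OF K(1) \<delta>(4)] by blast
  have "\<forall>x\<in>X. \<exists>\<phi>. continuous_on K \<phi> \<and> \<phi> ` K \<subseteq> K \<inter> cball x (\<delta> / 3) \<and>
      (\<forall>u\<in>K. \<forall>v\<in>K. r * dist u v \<le> dist (\<phi> u) (\<phi> v))"
    using copy[of "\<delta> / 3"] \<delta> X(1) by (auto simp: r_def)
  then obtain \<phi> where \<phi>: "\<And>x. x \<in> X \<Longrightarrow> continuous_on K (\<phi> x)"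
    "\<And>x. x \<in> X \<Longrightarrow> \<phi> x ` K \<subseteq> K \<inter> cball x (\<delta> / 3)"
    "\<And>x u v. x \<in> X \<Longrightarrow> u \<in> K \<Longrightarrow> v \<in> K \<Longrightarrow> r * dist u v \<le> dist (\<phi> x u) (\<phi> x v)"
    by metis
  have sep: "\<delta> / 3 \<le> dist (\<phi> x u) (\<phi> y v)" if "x \<in> X" "y \<in> X" "x \<noteq> y" "u \<in> K" "v \<in> K" for x y u v
  proof -
    have "\<phi> x u \<in> cball x (\<delta> / 3)" "\<phi> y v \<in> cball y (\<delta> / 3)" using \<phi>(2) that by blast+
    then have "dist x (\<phi> x u) \<le> \<delta> / 3" "dist y (\<phi> y v) \<le> \<delta> / 3" by simp_all
    moreover have "dist x y \<le> dist x (\<phi> x u) + dist (\<phi> x u) (\<phi> y v) + dist y (\<phi> y v)"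
      using dist_triangle[of x y "\<phi> x u"] dist_triangle2[of "\<phi> x u" y "\<phi> y v"] by (simp add: dist_commute)
    ultimately show ?thesis using X(3)[OF that(1-3)] by linarith
  qed
  have many: "1 \<le> real (card X) * r powr t"
  proof -
    have N: "1 \<le> real (covering_number K \<delta>)" using covering_number_pos[OF K \<delta>(4)] by simp
    have "- s' * ln \<delta> \<le> ln (real (covering_number K \<delta>))"
      using less \<delta> by (simp add: field_simps)
    then have "\<delta> powr (- s') \<le> real (covering_number K \<delta>)"
      using N \<delta> by (simp add: powr_def ln_ge_iff)
    also have "\<dots> \<le> real (card X)" using covering_number_le[OF X(2,4)] by simp
    finally have card: "\<delta> powr (- s') \<le> real (card X)" .
    have "\<delta> powr s' = \<delta> powr (s' - (1 + a) * s) * \<delta> powr ((1 + a) * s)"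
      using powr_add[of \<delta> "s' - (1 + a) * s" "(1 + a) * s"] by simp
    also have "\<dots> \<le> b powr s * \<delta> powr ((1 + a) * s)" using \<delta>(1) by (intro mult_right_mono) auto
    also have "\<dots> = r powr s" using b \<delta> by (simp add: r_eq powr_mult powr_powr)
    also have "\<dots> \<le> r powr t" using r t by (intro powr_mono') auto
    finally have "\<delta> powr (- s') * \<delta> powr s' \<le> real (card X) * r powr t"
      using card by (intro mult_mono) auto
    moreover have "\<delta> powr (- s') * \<delta> powr s' = 1"
      using powr_add[of \<delta> "- s'" s'] \<delta>(4) by simp
    ultimately show ?thesis by simp
  qed
  have "ennreal ((\<delta> / 3) powr t) \<le> hausdorff_premeasure t 1 K"
    unfolding hausdorff_premeasure_def
  proof (rule INF_greatest)
    fix U :: "nat \<Rightarrow> 'a set"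
    assume "U \<in> {U. K \<subseteq> (\<Union>i. U i) \<and> (\<forall>i. bounded (U i) \<and> diameter (U i) \<le> 1)}"
    then have U: "K \<subseteq> (\<Union>i. U i)" "\<And>i. bounded (U i)" by auto
    show "ennreal ((\<delta> / 3) powr t) \<le> (\<Sum>i. ennreal (diameter (U i) powr t))"
    proof (rule separated_expansion_outer_measure[where \<phi> = \<phi> and J = X, OF K X(2) \<phi>(1) _ \<phi>(3) sep r _ t(1) many U])
      show "\<phi> x ` K \<subseteq> K" if "x \<in> X" for x using \<phi>(2)[OF that] by blast
      show "0 < \<delta> / 3" using \<delta>(4) by simp
    qed
  qed
  also have "\<dots> \<le> hausdorff_outer_measure t K"
    unfolding hausdorff_outer_measure_def by (intro SUP_upper) auto
  finally have "ennreal ((\<delta> / 3) powr t) \<le> 0" using t(3) by simp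
  moreover have "0 < (\<delta> / 3) powr t" using \<delta>(4) by simp
  ultimately show False by (simp add: ennreal_eq_0_iff)
qed

section \<open>Derivatives within a convex set\<close>

text \<open>
  At a boundary point there need not be a coordinate direction along which the set can be entered,
  so uniqueness is obtained from the directions \<open>p - x\<close> with \<open>p \<in> S\<close>: the derivative along the
  segment from \<open>x\<close> to \<open>p\<close> is unique, and differences of these directions fill a ball.
\<close>

lemma has_derivative_within_convex_unique:
  fixes f :: "'a::euclidean_space \<Rightarrow> 'b::euclidean_space"
  assumes S: "convex S" "interior S \<noteq> {}" "x \<in> S"
    and A: "(f has_derivative A) (at x within S)" and B: "(f has_derivative B) (at x within S)"
  shows "A = B"
proof -
  have linA: "linear A" and linB: "linear B" using A B has_derivative_linear by blast+
  have eq: "A (p - x) = B (p - x)" if p: "p \<in> S" for p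
  proof -
    define \<gamma> where "\<gamma> t = x + t *\<^sub>R (p - x)" for t
    have \<gamma>: "(\<gamma> has_derivative (\<lambda>t. t *\<^sub>R (p - x))) (at 0 within cbox 0 (1::real))"
      unfolding \<gamma>_def by (auto intro!: derivative_eq_intros)
    have into: "\<gamma> ` cbox 0 1 \<subseteq> S"
    proof (clarsimp simp: \<gamma>_def)
      fix t :: real assume "0 \<le> t" "t \<le> 1"
      then have "(1 - t) *\<^sub>R x + t *\<^sub>R p \<in> S" using S(1,3) p by (intro convexD) auto
      then show "x + t *\<^sub>R (p - x) \<in> S" by (simp add: algebra_simps)
    qed
    have vec: "((f \<circ> \<gamma>) has_vector_derivative D (p - x)) (at 0 within cbox 0 1)"
      if D: "(f has_derivative D) (at x within S)" for D
    proof -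
      have "(f has_derivative D) (at (\<gamma> 0) within \<gamma> ` cbox 0 1)"
        using has_derivative_subset[OF D into] by (simp add: \<gamma>_def)
      from diff_chain_within[OF \<gamma> this]
      show ?thesis using has_derivative_linear[OF D]
        by (simp add: has_vector_derivative_def o_def linear_cmul)
    qed
    show ?thesis
      by (rule vector_derivative_unique_within_closed_interval[OF _ _ vec[OF A] vec[OF B]]) auto
  qed
  obtain c where "c \<in> interior S" using S(2) by blast
  then obtain e where c: "0 < e" "ball c e \<subseteq> S" unfolding mem_interior by blast
  show "A = B"
  proof
    fix h :: 'a
    define s where "s = e / (2 * (norm h + 1))"
    have pos: "0 < norm h + 1" using norm_ge_zero[of h] by linarith
    then have "0 < s" "s * (2 * (norm h + 1)) = e" using c by (auto simp: s_def)
    moreover have "s * (2 * (norm h + 1)) = 2 * (s * norm h) + 2 * s" by (simp add: algebra_simps)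
    moreover have "0 \<le> s * norm h" using \<open>0 < s\<close> by simp
    ultimately have s: "0 < s" "s * norm h < e" by linarith+
    have "c \<in> S" "c + s *\<^sub>R h \<in> S" using c s by (auto simp: subset_iff dist_norm)
    from this[THEN eq] have "A (c + s *\<^sub>R h - x) - A (c - x) = B (c + s *\<^sub>R h - x) - B (c - x)"
      by simp
    moreover have "T (c + s *\<^sub>R h - x) - T (c - x) = s *\<^sub>R T h" if "linear T" for T :: "'a \<Rightarrow> 'b"
      using linear_diff[OF that, of "c + s *\<^sub>R h - x" "c - x"] linear_scale[OF that, of s h] by simp
    ultimately have "s *\<^sub>R A h = s *\<^sub>R B h" using linA linB by metis
    then show "A h = B h" using s by simp
  qed
qed

lemma deriv_on_eq:
  fixes f :: "'a::euclidean_space \<Rightarrow> 'b::euclidean_space"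
  assumes "convex S" "interior S \<noteq> {}" "x \<in> S" "(f has_derivative A) (at x within S)"
  shows "blinfun_apply (deriv_on S f x) = A"
proof -
  have "(f has_derivative frechet_derivative f (at x within S)) (at x within S)"
    using assms(4) frechet_derivative_works differentiableI by blast
  then have "frechet_derivative f (at x within S) = A"
    using has_derivative_within_convex_unique assms by blast
  then show ?thesis
    using has_derivative_bounded_linear[OF assms(4)] by (simp add: deriv_on_def bounded_linear_Blinfun_apply)
qed

lemma convex_nonempty_interior_cball:
  "convex (cball 0 1 :: 'a::euclidean_space set)" "interior (cball 0 1 :: 'a set) \<noteq> {}"
  by auto

lemma C1_on_deriv_on:
  fixes f :: "'a::euclidean_space \<Rightarrow> 'b::euclidean_space"
  assumes f: "C1_on S f" and S: "convex S" "interior S \<noteq> {}"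
  shows "\<And>x. x \<in> S \<Longrightarrow> (f has_derivative blinfun_apply (deriv_on S f x)) (at x within S)"
    and "continuous_on S (deriv_on S f)"
proof -
  obtain f' where f': "\<And>x. x \<in> S \<Longrightarrow> (f has_derivative blinfun_apply (f' x)) (at x within S)"
    "continuous_on S f'"
    using f unfolding C1_on_def by blast
  have eq: "deriv_on S f x = f' x" if "x \<in> S" for x
    using deriv_on_eq[OF S that f'(1)[OF that]] by (simp add: blinfun_apply_inject)
  show "x \<in> S \<Longrightarrow> (f has_derivative blinfun_apply (deriv_on S f x)) (at x within S)" for x
    using f'(1) eq by simp
  show "continuous_on S (deriv_on S f)" using f'(2) eq by (simp cong: continuous_on_cong)
qed

lemma diffeo_deriv_inj:
  fixes f :: "'a::euclidean_space \<Rightarrow> 'a"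
  assumes f: "diffeo_onto_image S f" and S: "convex S" "interior S \<noteq> {}" and x: "x \<in> S"
    and zero: "blinfun_apply (deriv_on S f x) h = 0"
  shows "h = 0"
proof -
  let ?g = "the_inv_into S f"
  have inj: "inj_on f S" and f1: "C1_on S f" and "C1_on (f ` S) ?g"
    using f by (auto simp: diffeo_onto_image_def)
  then obtain g' where g': "\<And>y. y \<in> f ` S \<Longrightarrow> (?g has_derivative blinfun_apply (g' y)) (at y within f ` S)"
    unfolding C1_on_def by blast
  have "((?g \<circ> f) has_derivative (blinfun_apply (g' (f x)) \<circ> blinfun_apply (deriv_on S f x))) (at x within S)"
    using C1_on_deriv_on(1)[OF f1 S x] g' x by (intro diff_chain_within) auto
  then have "((\<lambda>y. y) has_derivative (blinfun_apply (g' (f x)) \<circ> blinfun_apply (deriv_on S f x))) (at x within S)"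
    by (rule has_derivative_transform[OF x, rotated]) (simp add: the_inv_into_f_f[OF inj])
  then have "blinfun_apply (g' (f x)) \<circ> blinfun_apply (deriv_on S f x) = (\<lambda>h. h)"
    by (rule has_derivative_within_convex_unique[OF S x _ has_derivative_ident])
  from fun_cong[OF this, of h] show "h = 0" using zero by (simp add: blinfun.zero_right)
qed

text \<open>
  The function \<open>(x, h) \<mapsto> norm (D f x h)\<close> is continuous and has no zeros on the product of \<open>S\<close> and the
  unit sphere, hence is bounded away from \<open>0\<close> and from \<open>\<infinity>\<close> there.
\<close>

lemma diffeo_deriv_bounds:
  fixes f :: "'a::euclidean_space \<Rightarrow> 'a"
  assumes f: "diffeo_onto_image S f" and S: "convex S" "interior S \<noteq> {}" "compact S"
  shows "\<exists>c>0. \<forall>x\<in>S. \<forall>h. norm h \<le> c * norm (blinfun_apply (deriv_on S f x) h) \<and>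
           norm (blinfun_apply (deriv_on S f x) h) \<le> c * norm h"
proof -
  let ?D = "deriv_on S f"
  have f1: "C1_on S f" using f by (auto simp: diffeo_onto_image_def)
  have cont: "continuous_on S ?D" using C1_on_deriv_on(2)[OF f1 S(1,2)] .
  have "bounded (?D ` S)" using cont S(3) compact_continuous_image compact_imp_bounded by blast
  then obtain B where B: "\<And>x. x \<in> S \<Longrightarrow> norm (?D x) \<le> B" unfolding bounded_iff by blast
  let ?P = "S \<times> sphere (0::'a) 1"
  have "compact ?P" using S(3) by (intro compact_Times) auto
  moreover have "?P \<noteq> {}" using S(2) interior_subset[of S] by (auto simp: sphere_eq_empty)
  moreover have "continuous_on ?P (\<lambda>(x, h). norm (blinfun_apply (?D x) h))"
    unfolding case_prod_beta
    by (intro continuous_intros continuous_on_compose2[OF cont]) auto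
  ultimately obtain z where z: "z \<in> ?P"
    "\<And>p. p \<in> ?P \<Longrightarrow> (\<lambda>(x, h). norm (blinfun_apply (?D x) h)) z \<le> (\<lambda>(x, h). norm (blinfun_apply (?D x) h)) p"
    by (metis continuous_attains_inf)
  obtain x0 h0 where zeq: "z = (x0, h0)" by (cases z)
  define m where "m = norm (blinfun_apply (?D x0) h0)"
  have "x0 \<in> S" "norm h0 = 1" using z zeq by auto
  then have "0 < m"
    using diffeo_deriv_inj[OF f S(1,2), of x0 h0] by (auto simp: m_def)
  have low: "m * norm h \<le> norm (blinfun_apply (?D x) h)" if "x \<in> S" for x and h :: 'a
  proof (cases "h = 0")
    case False
    then have "(x, h /\<^sub>R norm h) \<in> ?P" using that by auto
    from z(2)[OF this] False show ?thesis
      by (simp add: zeq m_def blinfun.scaleR_right divide_simps mult.commute)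
  qed auto
  define c where "c = max (1 / m) B"
  have "0 < c" "1 / m \<le> c" "B \<le> c" using \<open>0 < m\<close> by (auto simp: c_def less_max_iff_disj)
  show ?thesis
  proof (intro exI[of _ c] conjI ballI allI \<open>0 < c\<close>)
    fix x h :: 'a assume x: "x \<in> S"
    have "norm h = (1 / m) * (m * norm h)" using \<open>0 < m\<close> by simp
    also have "\<dots> \<le> c * norm (blinfun_apply (?D x) h)"
      using low[OF x] \<open>1 / m \<le> c\<close> \<open>0 < c\<close> \<open>0 < m\<close> by (intro mult_mono) auto
    finally show "norm h \<le> c * norm (blinfun_apply (?D x) h)" .
    have "norm (blinfun_apply (?D x) h) \<le> norm (?D x) * norm h" by (rule norm_blinfun)
    also have "\<dots> \<le> c * norm h" using B[OF x] \<open>B \<le> c\<close> by (intro mult_right_mono) auto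
    finally show "norm (blinfun_apply (?D x) h) \<le> c * norm h" .
  qed
qed

section \<open>Uniform estimates for compact families\<close>

lemma C1_dist_upper:
  fixes f g :: "'a::euclidean_space \<Rightarrow> 'a"
  assumes "0 \<le> \<alpha>" "f \<in> D1 L \<alpha>" "g \<in> D1 L \<alpha>" "x \<in> cball 0 1"
  shows "norm (f x - g x) \<le> C1_dist f g"
    and "norm (deriv_on (cball 0 1) f x - deriv_on (cball 0 1) g x) \<le> C1_dist f g"
proof -
  have "norm (f x - g x) + norm (deriv_on (cball 0 1) f x - deriv_on (cball 0 1) g x) \<le> C1_dist f g"
    unfolding C1_dist_def by (rule cSUP_upper[OF assms(4) D1_bdd_above[OF assms(1-3)]])
  then show "norm (f x - g x) \<le> C1_dist f g"
    "norm (deriv_on (cball 0 1) f x - deriv_on (cball 0 1) g x) \<le> C1_dist f g"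
    using norm_ge_zero[of "f x - g x"] norm_ge_zero[of "deriv_on (cball 0 1) f x - deriv_on (cball 0 1) g x"]
    by linarith+
qed

lemma DIFS_subset_D1:
  assumes "0 \<le> \<alpha>" "F \<in> DIFS L \<alpha>" shows "F \<subseteq> D1 L \<alpha>"
proof -
  have "compactin (Metric_space.mtopology (D1 L \<alpha>) (D1_dist L \<alpha>)) F"
    using assms(2) by (simp add: DIFS_def C1_topology_def)
  from compactin_subset_topspace[OF this] show ?thesis
    by (simp add: Metric_space.topspace_mtopology[OF Metric_space_D1[OF assms(1)]])
qed

text \<open>
  Bounds for one map persist, with a worse constant, in a \<open>C\<^sup>1\<close>-neighbourhood of it, and finitely many
  such neighbourhoods cover the family.
\<close>

lemma DIFS_deriv_bounds:
  fixes F :: "('a::euclidean_space \<Rightarrow> 'a) set"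
  assumes \<alpha>: "0 \<le> \<alpha>" and F: "F \<in> DIFS L \<alpha>"
  shows "\<exists>c>0. \<forall>f\<in>F. \<forall>x\<in>cball 0 1. \<forall>h.
    norm h \<le> c * norm (blinfun_apply (deriv_on (cball 0 1) f x) h) \<and>
    norm (blinfun_apply (deriv_on (cball 0 1) f x) h) \<le> c * norm h"
proof -
  let ?D = "deriv_on (cball 0 1)"
  interpret Metric_space "D1 L \<alpha> :: ('a \<Rightarrow> 'a) set" "D1_dist L \<alpha>" by (rule Metric_space_D1[OF \<alpha>])
  note sub = DIFS_subset_D1[OF \<alpha> F]
  define good where "good c f \<longleftrightarrow> (\<forall>x\<in>cball 0 1. \<forall>h.
    norm h \<le> c * norm (blinfun_apply (?D f x) h) \<and> norm (blinfun_apply (?D f x) h) \<le> c * norm h)"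
    for c and f :: "'a \<Rightarrow> 'a"
  have mono: "good c' f" if "good c f" "c \<le> c'" for c c' f
    unfolding good_def
  proof (intro ballI allI conjI)
    fix x h :: 'a assume "x \<in> cball 0 1"
    then have "norm h \<le> c * norm (blinfun_apply (?D f x) h)" "norm (blinfun_apply (?D f x) h) \<le> c * norm h"
      using that(1) by (auto simp: good_def)
    moreover have "c * norm y \<le> c' * norm y" for y :: 'a using that(2) by (simp add: mult_right_mono)
    ultimately show "norm h \<le> c' * norm (blinfun_apply (?D f x) h)" "norm (blinfun_apply (?D f x) h) \<le> c' * norm h"
      by (blast intro: order_trans)+
  qed
  have "\<exists>c e. 0 < c \<and> 0 < e \<and> (\<forall>g\<in>mball f e. good c g)" if f: "f \<in> F" for f
  proof -
    have fD: "f \<in> D1 L \<alpha>" using f sub by blast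
    then have "diffeo_onto_image (cball 0 1) f" by (simp add: D1_def)
    from diffeo_deriv_bounds[OF this convex_nonempty_interior_cball compact_cball]
    obtain c where c: "0 < c" "good c f" by (auto simp: good_def)
    \<comment> \<open>With this radius the perturbation of the derivative costs at most half of the lower
      bound \<open>norm h / c\<close>.\<close>
    define e where "e = 1 / (2 * c)"
    have e: "0 < e" "c * e = 1 / 2" using c by (auto simp: e_def)
    have "good (2 * c + e) g" if g: "g \<in> mball f e" for g
      unfolding good_def
    proof (intro ballI allI conjI)
      fix x h :: 'a assume x: "x \<in> cball 0 1"
      have gD: "g \<in> D1 L \<alpha>" and "C1_dist f g < e" using g by (auto simp: D1_dist_def)
      then have "norm (?D f x - ?D g x) \<le> e" using C1_dist_upper(2)[OF \<alpha> fD gD x] by simp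
      then have "norm (?D f x - ?D g x) * norm h \<le> e * norm h" by (intro mult_right_mono) auto
      then have diff: "norm (blinfun_apply (?D f x) h - blinfun_apply (?D g x) h) \<le> e * norm h"
        using norm_blinfun[of "?D f x - ?D g x" h] by (simp add: blinfun.diff_left)
      have bound: "norm h \<le> c * norm (blinfun_apply (?D f x) h)" "norm (blinfun_apply (?D f x) h) \<le> c * norm h"
        using c x by (auto simp: good_def)
      have "norm (blinfun_apply (?D f x) h) \<le> norm (blinfun_apply (?D g x) h) + e * norm h"
        using diff norm_triangle_ineq2[of "blinfun_apply (?D f x) h" "blinfun_apply (?D g x) h"] by linarith
      then have "c * norm (blinfun_apply (?D f x) h) \<le> c * (norm (blinfun_apply (?D g x) h) + e * norm h)"
        using c by (intro mult_left_mono) auto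
      with bound(1) have "norm h \<le> c * (norm (blinfun_apply (?D g x) h) + e * norm h)" by linarith
      also have "\<dots> = c * norm (blinfun_apply (?D g x) h) + norm h / 2"
        using e by (simp add: distrib_left flip: mult.assoc)
      finally have "norm h \<le> 2 * c * norm (blinfun_apply (?D g x) h)" by simp
      also have "\<dots> \<le> (2 * c + e) * norm (blinfun_apply (?D g x) h)" using e by (intro mult_right_mono) auto
      finally show "norm h \<le> (2 * c + e) * norm (blinfun_apply (?D g x) h)" .
      have "norm (blinfun_apply (?D g x) h) \<le> norm (blinfun_apply (?D f x) h) + e * norm h"
        using diff norm_triangle_ineq2[of "blinfun_apply (?D g x) h" "blinfun_apply (?D f x) h"]
        by (simp add: norm_minus_commute)
      also have "\<dots> \<le> c * norm h + e * norm h" using bound by simp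
      also have "\<dots> \<le> (2 * c + e) * norm h" using c by (simp add: distrib_right)
      finally show "norm (blinfun_apply (?D g x) h) \<le> (2 * c + e) * norm h" .
    qed
    then show ?thesis using c e by (intro exI[of _ "2 * c + e"] exI[of _ e]) auto
  qed
  then obtain c e where ce: "\<And>f. f \<in> F \<Longrightarrow> 0 < c f" "\<And>f. f \<in> F \<Longrightarrow> 0 < e f"
    "\<And>f g. f \<in> F \<Longrightarrow> g \<in> mball f (e f) \<Longrightarrow> good (c f) g"
    by metis
  have "compactin mtopology F" using F by (simp add: DIFS_def C1_topology_def)
  moreover have "F \<subseteq> \<Union> ((\<lambda>f. mball f (e f)) ` F)" using ce(2) sub by fastforce
  moreover have "\<forall>U \<in> (\<lambda>f. mball f (e f)) ` F. openin mtopology U" by auto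
  ultimately have "\<exists>T. finite T \<and> T \<subseteq> (\<lambda>f. mball f (e f)) ` F \<and> F \<subseteq> \<Union> T"
    unfolding compactin_def by blast
  then obtain T where T: "finite T" "T \<subseteq> (\<lambda>f. mball f (e f)) ` F" "F \<subseteq> \<Union> T" by blast
  from finite_subset_image[OF T(1,2)]
  obtain G where G: "G \<subseteq> F" "finite G" "T = (\<lambda>f. mball f (e f)) ` G" by blast
  define b where "b = (\<Sum>f\<in>G. c f)"
  have le: "c f \<le> b" if "f \<in> G" for f
    unfolding b_def using that G ce(1) by (intro member_le_sum) (auto intro: less_imp_le)
  have "G \<noteq> {}" using F G T by (auto simp: DIFS_def)
  then have "0 < b" unfolding b_def using G ce(1) by (intro sum_pos) auto
  moreover have "good b g" if "g \<in> F" for g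
  proof -
    obtain f where "f \<in> G" "g \<in> mball f (e f)" using \<open>g \<in> F\<close> T(3) G by blast
    then show ?thesis using ce(3) le mono G by blast
  qed
  ultimately show ?thesis unfolding good_def by blast
qed

text \<open>
  Sequential compactness of the family and of \<open>A\<close> lets one pass to the limit in \<open>x n = f n (y n)\<close>,
  since \<open>C\<^sup>1\<close>-convergence implies uniform convergence.
\<close>

lemma DIFS_closed_image:
  fixes F :: "('a::euclidean_space \<Rightarrow> 'a) set"
  assumes \<alpha>: "0 \<le> \<alpha>" and F: "F \<in> DIFS L \<alpha>" and A: "compact A" "A \<subseteq> cball 0 1"
  shows "closed (ifs_map F A)"
proof -
  interpret Metric_space "D1 L \<alpha> :: ('a \<Rightarrow> 'a) set" "D1_dist L \<alpha>" by (rule Metric_space_D1[OF \<alpha>])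
  have FD: "F \<subseteq> D1 L \<alpha>" by (rule DIFS_subset_D1[OF \<alpha> F])
  have "compactin mtopology F" using F by (simp add: DIFS_def C1_topology_def)
  then have seqF: "\<exists>g r. g \<in> F \<and> strict_mono r \<and> limitin mtopology (f \<circ> r) g sequentially"
    if "range f \<subseteq> F" for f :: "nat \<Rightarrow> 'a \<Rightarrow> 'a"
    using that unfolding compactin_sequentially by blast
  show ?thesis unfolding closed_sequential_limits
  proof (intro allI impI, elim conjE)
    fix x l assume xn: "\<forall>n. x n \<in> ifs_map F A" and lim: "x \<longlonglongrightarrow> l"
    have "\<forall>n. \<exists>f y. f \<in> F \<and> y \<in> A \<and> x n = f y" using xn unfolding ifs_map_def by blast
    then obtain f y where fy: "\<And>n. f n \<in> F" "\<And>n. y n \<in> A" "\<And>n. x n = f n (y n)" by metis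
    obtain g r where g: "g \<in> F" "strict_mono r" "limitin mtopology (f \<circ> r) g sequentially"
      using seqF[of f] fy(1) by blast
    obtain z r' where z: "z \<in> A" "strict_mono r'" "(y \<circ> r \<circ> r') \<longlonglongrightarrow> z"
      using A(1) fy(2) unfolding compact_def by (metis comp_apply)
    define k where "k = r \<circ> r'"
    have gD: "g \<in> D1 L \<alpha>" using g FD by blast
    have "(\<lambda>n. D1_dist L \<alpha> ((f \<circ> r) n) g) \<longlonglongrightarrow> 0"
      using g(3) unfolding limitin_metric_dist_null by blast
    from LIMSEQ_subseq_LIMSEQ[OF this z(2)]
    have d0: "(\<lambda>n. D1_dist L \<alpha> (f (k n)) g) \<longlonglongrightarrow> 0" by (simp add: k_def o_def)
    have "L-lipschitz_on (cball 0 1) g" using gD by (simp add: D1_def)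
    then have "continuous_on (cball 0 1) g" by (rule lipschitz_on_continuous_on)
    moreover have "(\<lambda>n. y (k n)) \<longlonglongrightarrow> z" using z(3) by (simp add: k_def o_def)
    ultimately have gy: "(\<lambda>n. g (y (k n))) \<longlonglongrightarrow> g z"
      using z(1) fy(2) A(2) by (intro continuous_on_tendsto_compose[of "cball 0 1" g]) (auto simp: subset_iff)
    have "norm (f (k n) (y (k n)) - g (y (k n))) \<le> D1_dist L \<alpha> (f (k n)) g" for n
    proof -
      have fD: "f (k n) \<in> D1 L \<alpha>" and yb: "y (k n) \<in> cball 0 1" using fy FD A(2) by blast+
      show ?thesis using C1_dist_upper(1)[OF \<alpha> fD gD yb] fD gD by (simp add: D1_dist_def)
    qed
    then have "(\<lambda>n. f (k n) (y (k n)) - g (y (k n))) \<longlonglongrightarrow> 0"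
      by (intro Lim_null_comparison[OF _ d0]) auto
    from tendsto_add[OF this gy] have "(\<lambda>n. x (k n)) \<longlonglongrightarrow> g z" by (simp add: fy(3))
    moreover have "(\<lambda>n. x (k n)) \<longlonglongrightarrow> l"
      using LIMSEQ_subseq_LIMSEQ[OF lim strict_mono_o[OF g(2) z(2)]] by (simp add: k_def o_def)
    ultimately have "l = g z" by (metis LIMSEQ_unique)
    then show "l \<in> ifs_map F A" using g(1) z(1) by (auto simp: ifs_map_def)
  qed
qed

section \<open>Words and the limit set\<close>

lemma fold_comp_start:
  fixes g :: "'a \<Rightarrow> 'a"
  shows "fold (\<circ>) fs g = fold (\<circ>) fs id \<circ> g"
proof (induction fs arbitrary: g)
  case (Cons f fs)
  show ?case using Cons[of "f \<circ> g"] Cons[of f] by (simp add: o_assoc)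
qed simp

definition word :: "('a \<Rightarrow> 'a) list \<Rightarrow> 'a \<Rightarrow> 'a"
  where "word fs = fold (\<circ>) fs id"

lemma word_Nil: "word [] = id"
  by (simp add: word_def)

lemma word_snoc: "word (fs @ [f]) = f \<circ> word fs"
  by (simp add: word_def)

lemma word_Cons: "word (f # fs) = word fs \<circ> f"
  using fold_comp_start[of fs f] by (simp add: word_def)

text \<open>
  The consequences of compactness of a system that the rest of the argument relies on: uniform
  Hoelder and invertibility constants for the derivatives, and closed images of compact sets.
\<close>

locale contracting_system =
  fixes F :: "('a::euclidean_space \<Rightarrow> 'a) set" and L \<alpha> C K :: real
  assumes nonempty: "F \<noteq> {}"
    and L: "0 < L" "L < 1" and \<alpha>: "0 < \<alpha>" and C: "0 \<le> C" and K: "0 < K"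
    and into: "\<And>f. f \<in> F \<Longrightarrow> f ` cball 0 1 \<subseteq> cball 0 1"
    and inj: "\<And>f. f \<in> F \<Longrightarrow> inj_on f (cball 0 1)"
    and lipschitz: "\<And>f x y. f \<in> F \<Longrightarrow> x \<in> cball 0 1 \<Longrightarrow> y \<in> cball 0 1 \<Longrightarrow> dist (f x) (f y) \<le> L * dist x y"
    and deriv: "\<And>f x. f \<in> F \<Longrightarrow> x \<in> cball 0 1 \<Longrightarrow>
      (f has_derivative blinfun_apply (deriv_on (cball 0 1) f x)) (at x within cball 0 1)"
    and hoelder: "\<And>f x y. f \<in> F \<Longrightarrow> x \<in> cball 0 1 \<Longrightarrow> y \<in> cball 0 1 \<Longrightarrow>
      norm (deriv_on (cball 0 1) f x - deriv_on (cball 0 1) f y) \<le> C * norm (x - y) powr \<alpha>"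
    and deriv_lower: "\<And>f x h. f \<in> F \<Longrightarrow> x \<in> cball 0 1 \<Longrightarrow>
      norm h \<le> K * norm (blinfun_apply (deriv_on (cball 0 1) f x) h)"
    and deriv_upper: "\<And>f x h. f \<in> F \<Longrightarrow> x \<in> cball 0 1 \<Longrightarrow>
      norm (blinfun_apply (deriv_on (cball 0 1) f x) h) \<le> K * norm h"
    and closed_image: "\<And>A. compact A \<Longrightarrow> A \<subseteq> cball 0 1 \<Longrightarrow> closed (ifs_map F A)"
begin

abbreviation D :: "('a \<Rightarrow> 'a) \<Rightarrow> 'a \<Rightarrow> 'a \<Rightarrow> 'a"
  where "D f x \<equiv> blinfun_apply (deriv_on (cball 0 1) f x)"

lemma word_into: "set fs \<subseteq> F \<Longrightarrow> x \<in> cball 0 1 \<Longrightarrow> word fs x \<in> cball 0 1"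
proof (induction fs rule: rev_induct)
  case (snoc f fs)
  then have "word fs x \<in> cball 0 1" "f \<in> F" by auto
  then have "f (word fs x) \<in> cball 0 1" using into[of f] by blast
  then show ?case by (simp add: word_snoc)
qed (simp add: word_Nil)

lemma word_lipschitz:
  "set fs \<subseteq> F \<Longrightarrow> x \<in> cball 0 1 \<Longrightarrow> y \<in> cball 0 1 \<Longrightarrow>
    dist (word fs x) (word fs y) \<le> L ^ length fs * dist x y"
proof (induction fs rule: rev_induct)
  case (snoc f fs)
  then have "dist (f (word fs x)) (f (word fs y)) \<le> L * dist (word fs x) (word fs y)"
    by (intro lipschitz word_into) auto
  also have "\<dots> \<le> L * (L ^ length fs * dist x y)"
    using snoc L by (intro mult_left_mono) auto
  finally show ?case by (simp add: mult_ac word_snoc)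
qed (simp add: word_Nil)

lemma word_dist_le:
  assumes "set fs \<subseteq> F" "x \<in> cball 0 1" "y \<in> cball 0 1"
  shows "dist (word fs x) (word fs y) \<le> 2 * L ^ length fs"
proof -
  have "dist x y \<le> 2" using assms(2,3) dist_triangle2[of x y 0] by (simp add: dist_commute)
  then have "L ^ length fs * dist x y \<le> L ^ length fs * 2" using L by (intro mult_left_mono) auto
  then show ?thesis using word_lipschitz[OF assms] by simp
qed

lemma word_continuous: "set fs \<subseteq> F \<Longrightarrow> continuous_on (cball 0 1) (word fs)"
  using word_lipschitz L by (intro lipschitz_on_continuous_on[of "L ^ length fs"]) (auto simp: lipschitz_on_def)

lemma word_has_derivative:
  "set fs \<subseteq> F \<Longrightarrow> x \<in> cball 0 1 \<Longrightarrow> (word fs has_derivative D (word fs) x) (at x within cball 0 1)"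
  "set (fs @ [f]) \<subseteq> F \<Longrightarrow> x \<in> cball 0 1 \<Longrightarrow> D (word (fs @ [f])) x = D f (word fs x) \<circ> D (word fs) x"
proof -
  have chain: "(f \<circ> word fs has_derivative D f (word fs x) \<circ> D (word fs) x) (at x within cball 0 1)"
    if "(word fs has_derivative D (word fs) x) (at x within cball 0 1)" "set (fs @ [f]) \<subseteq> F" "x \<in> cball 0 1"
    for fs f x
  proof (rule diff_chain_within[OF that(1)])
    have "(f has_derivative D f (word fs x)) (at (word fs x) within cball 0 1)"
      using that by (intro deriv word_into) auto
    then show "(f has_derivative D f (word fs x)) (at (word fs x) within word fs ` cball 0 1)"
      by (rule has_derivative_subset) (use that word_into in auto)
  qed
  show der: "(word fs has_derivative D (word fs) x) (at x within cball 0 1)"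
    if "set fs \<subseteq> F" "x \<in> cball 0 1" for fs x
    using that(1)
  proof (induction fs rule: rev_induct)
    case Nil
    have "(id has_derivative id) (at x within cball 0 1)" unfolding id_def by (rule has_derivative_ident)
    then show ?case
      using deriv_on_eq[OF convex_nonempty_interior_cball that(2), of id id] by (simp only: word_Nil)
  next
    case (snoc f fs)
    have "(f \<circ> word fs has_derivative D f (word fs x) \<circ> D (word fs) x) (at x within cball 0 1)"
      using snoc that(2) by (intro chain) auto
    then show ?case
      using deriv_on_eq[OF convex_nonempty_interior_cball that(2), of "f \<circ> word fs"] by (simp only: word_snoc)
  qed
  show "D (word (fs @ [f])) x = D f (word fs x) \<circ> D (word fs) x"
    if "set (fs @ [f]) \<subseteq> F" "x \<in> cball 0 1" for fs f x
    unfolding word_snoc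
  proof (rule deriv_on_eq[OF convex_nonempty_interior_cball that(2) chain[OF der that]])
    show "set fs \<subseteq> F" "x \<in> cball 0 1" using that by auto
  qed
qed

lemma deriv_word_Cons:
  assumes "set (f # fs) \<subseteq> F" "x \<in> cball 0 1"
  shows "D (word (f # fs)) x = D (word fs) (f x) \<circ> D f x"
proof -
  have fx: "f x \<in> cball 0 1" using word_into[of "[f]" x] assms by (simp add: word_def)
  have "(word fs \<circ> f has_derivative D (word fs) (f x) \<circ> D f x) (at x within cball 0 1)"
  proof (rule diff_chain_within)
    show "(f has_derivative D f x) (at x within cball 0 1)" using assms by (intro deriv) auto
    have "(word fs has_derivative D (word fs) (f x)) (at (f x) within cball 0 1)"
      using assms fx by (intro word_has_derivative) auto
    then show "(word fs has_derivative D (word fs) (f x)) (at (f x) within f ` cball 0 1)"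
      by (rule has_derivative_subset) (use assms into[of f] in auto)
  qed
  then show ?thesis
    unfolding word_Cons by (rule deriv_on_eq[OF convex_nonempty_interior_cball assms(2)])
qed

lemma deriv_word_bounds:
  "set fs \<subseteq> F \<Longrightarrow> x \<in> cball 0 1 \<Longrightarrow> norm h \<le> K ^ length fs * norm (D (word fs) x h) \<and>
    norm (D (word fs) x h) \<le> K ^ length fs * norm h"
proof (induction fs rule: rev_induct)
  case Nil
  have "(id has_derivative id) (at x within cball 0 1)" unfolding id_def by (rule has_derivative_ident)
  from deriv_on_eq[OF convex_nonempty_interior_cball Nil(2) this] show ?case
    by (simp only: word_Nil) simp
next
  case (snoc f fs)
  let ?v = "D (word fs) x h"
  have f: "f \<in> F" and IH: "norm h \<le> K ^ length fs * norm ?v" "norm ?v \<le> K ^ length fs * norm h"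
    and wx: "word fs x \<in> cball 0 1"
    using snoc word_into by auto
  have "norm h \<le> K ^ length fs * (K * norm (D f (word fs x) ?v))"
    using IH(1) mult_left_mono[OF deriv_lower[OF f wx, of ?v], of "K ^ length fs"] K
    by (meson less_imp_le order_trans zero_le_power)
  moreover have "norm (D f (word fs x) ?v) \<le> K * (K ^ length fs * norm h)"
    using deriv_upper[OF f wx, of ?v] mult_left_mono[OF IH(2), of K] K
    by (meson less_imp_le order_trans)
  ultimately show ?case
    unfolding word_has_derivative(2)[OF snoc(2,3)] by (simp add: mult_ac)
qed

lemma deriv_word_surj:
  assumes "set fs \<subseteq> F" "x \<in> cball 0 1"
  shows "bij (D (word fs) x)"
proof -
  have lin: "linear (D (word fs) x)" by (rule bounded_linear.linear[OF blinfun.bounded_linear_right])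
  moreover have "inj (D (word fs) x)"
    unfolding linear_injective_0[OF lin] using deriv_word_bounds[OF assms]
    by (metis mult_zero_right norm_le_zero_iff norm_zero)
  ultimately show ?thesis by (simp add: bij_def linear_injective_imp_surjective)
qed

lemma ifs_map_iff: "x \<in> ifs_map F A \<longleftrightarrow> (\<exists>f\<in>F. \<exists>y\<in>A. x = f y)"
  by (auto simp: ifs_map_def)

lemma invariant_address:
  assumes "ifs_map F A = A" "x \<in> A"
  shows "\<exists>fs y. length fs = n \<and> set fs \<subseteq> F \<and> y \<in> A \<and> x = word fs y"
  using assms(2)
proof (induction n arbitrary: x)
  case 0
  then show ?case by (intro exI[of _ "[]"] exI[of _ x]) (auto simp: word_Nil)
next
  case (Suc n)
  then obtain f z where f: "f \<in> F" "z \<in> A" "x = f z" using assms(1) ifs_map_iff by blast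
  with Suc.IH obtain fs y where "length fs = n" "set fs \<subseteq> F" "y \<in> A" "z = word fs y" by blast
  then show ?case using f by (intro exI[of _ "fs @ [f]"] exI[of _ y]) (auto simp: word_snoc)
qed

lemma invariant_word:
  "ifs_map F A = A \<Longrightarrow> x \<in> A \<Longrightarrow> set fs \<subseteq> F \<Longrightarrow> word fs x \<in> A"
proof (induction fs rule: rev_induct)
  case (snoc f fs)
  then have "f (word fs x) \<in> ifs_map F A" unfolding ifs_map_iff by auto
  then show ?case using snoc by (simp add: word_snoc)
qed (simp add: word_Nil)

lemma ex_word_contraction: "0 < e \<Longrightarrow> \<exists>n. 2 * L ^ n < e"
  using real_arch_pow_inv[of "e / 2" L] L by (auto simp: field_simps)

text \<open>
  A point of \<open>A\<close> is the image of some point under arbitrarily long words, and a long word maps any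
  point of \<open>B\<close> to a point of \<open>B\<close> close to it.
\<close>

lemma invariant_subset:
  assumes A: "A \<in> hyperspace" "ifs_map F A = A" and B: "B \<in> hyperspace" "ifs_map F B = B"
  shows "A \<subseteq> B"
proof
  fix x assume x: "x \<in> A"
  obtain b where b: "b \<in> B" using B by (auto simp: hyperspace_def)
  have "\<exists>y\<in>B. dist y x < e" if e: "0 < e" for e
  proof -
    obtain n where n: "2 * L ^ n < e" using ex_word_contraction[OF e] by blast
    obtain fs y where fs: "length fs = n" "set fs \<subseteq> F" "y \<in> A" "x = word fs y"
      using invariant_address[OF A(2) x] by blast
    have "dist (word fs b) x \<le> 2 * L ^ n"
      using word_dist_le[OF fs(2), of b y] fs b A(1) B(1) unfolding hyperspace_def by blast
    then show ?thesis using n invariant_word[OF B(2) b fs(2)] by force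
  qed
  then have "x \<in> closure B" by (simp add: closure_approachable)
  then show "x \<in> B" using B by (simp add: hyperspace_def compact_imp_closed)
qed

text \<open>
  The orbit \<open>A0\<close> of the fixed point \<open>z\<close> of one of the maps under all words is already invariant:
  \<open>z\<close> itself is an image of \<open>z\<close>. Its closure is compact, and closedness of its image gives
  invariance of the closure.
\<close>

lemma ex_invariant: "\<exists>A. A \<in> hyperspace \<and> ifs_map F A = A"
proof -
  obtain g where g: "g \<in> F" using nonempty by blast
  have "complete (cball (0::'a) 1)" by (simp add: compact_imp_complete)
  moreover have "cball (0::'a) 1 \<noteq> {}" by simp
  moreover have "\<And>x y. x \<in> cball 0 1 \<Longrightarrow> y \<in> cball 0 1 \<Longrightarrow> dist (g x) (g y) \<le> L * dist x y"
    using lipschitz[OF g] .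
  ultimately have "\<exists>!z\<in>cball 0 1. g z = z"
    using into[OF g] L by (intro Banach_fix[of _ L]) auto
  then obtain z where z: "z \<in> cball 0 1" "g z = z" by blast
  define A0 where "A0 = {word fs z |fs. set fs \<subseteq> F}"
  have sub: "A0 \<subseteq> cball 0 1" using word_into z by (auto simp: A0_def)
  have inv: "ifs_map F A0 = A0"
  proof (intro set_eqI iffI)
    fix x assume "x \<in> ifs_map F A0"
    then obtain f fs where "f \<in> F" "set fs \<subseteq> F" "x = f (word fs z)" by (auto simp: ifs_map_iff A0_def)
    then have "x = word (fs @ [f]) z" "set (fs @ [f]) \<subseteq> F" by (auto simp: word_snoc)
    then show "x \<in> A0" unfolding A0_def by blast
  next
    fix x assume "x \<in> A0"
    then obtain fs where fs: "set fs \<subseteq> F" "x = word fs z" by (auto simp: A0_def)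
    have z0: "z \<in> A0" unfolding A0_def by (auto intro!: exI[of _ "[]"] simp: word_Nil)
    show "x \<in> ifs_map F A0"
    proof (cases fs rule: rev_cases)
      case Nil
      then have "x = g z" using fs z by (simp add: word_Nil)
      then show ?thesis using g z0 unfolding ifs_map_iff by blast
    next
      case (snoc gs f)
      then have "word gs z \<in> A0" "f \<in> F" "x = f (word gs z)" using fs by (auto simp: A0_def word_snoc)
      then show ?thesis unfolding ifs_map_iff by blast
    qed
  qed
  let ?A = "closure A0"
  have subA: "?A \<subseteq> cball 0 1" using sub closed_cball by (rule closure_minimal)
  have comp: "compact ?A" using subA bounded_subset[OF bounded_cball] by (auto simp: compact_eq_bounded_closed)
  have "ifs_map F ?A = ?A"
  proof
    show "ifs_map F ?A \<subseteq> ?A"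
    proof
      fix x assume "x \<in> ifs_map F ?A"
      then obtain f y where f: "f \<in> F" "y \<in> ?A" "x = f y" unfolding ifs_map_iff by blast
      have "continuous_on ?A f"
        using word_continuous[of "[f]"] f(1) subA by (auto simp: word_def intro: continuous_on_subset)
      moreover have "f ` A0 \<subseteq> ?A"
        using inv f(1) closure_subset[of A0] unfolding ifs_map_iff set_eq_iff by blast
      ultimately have "f ` ?A \<subseteq> ?A" by (intro image_closure_subset) auto
      then show "x \<in> ?A" using f by blast
    qed
    have "A0 \<subseteq> ifs_map F ?A"
      using inv closure_subset[of A0] unfolding ifs_map_iff set_eq_iff subset_iff by blast
    then show "?A \<subseteq> ifs_map F ?A"
      by (rule closure_minimal[OF _ closed_image[OF comp subA]])
  qed
  moreover have "z \<in> A0" by (auto simp: A0_def word_Nil intro!: exI[of _ "[]"])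
  then have "?A \<noteq> {}" by auto
  ultimately show ?thesis using comp subA by (intro exI[of _ ?A]) (auto simp: hyperspace_def)
qed

lemma limit_set_invariant: "limit_set F \<in> hyperspace \<and> ifs_map F (limit_set F) = limit_set F"
  unfolding limit_set_def
proof (rule theI')
  show "\<exists>!A. A \<in> hyperspace \<and> ifs_map F A = A"
    using ex_invariant invariant_subset by (metis subset_antisym)
qed

lemma limit_set_compact: "compact (limit_set F)" "limit_set F \<noteq> {}" "limit_set F \<subseteq> cball 0 1"
  using limit_set_invariant by (auto simp: hyperspace_def)

section \<open>Linearization of words\<close>

lemma linearization_error:
  assumes f: "f \<in> F" and xy: "x \<in> cball 0 1" "y \<in> cball 0 1"
  shows "norm (f x - f y - D f y (x - y)) \<le> C * norm (x - y) powr \<alpha> * norm (x - y)"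
proof -
  let ?I = "closed_segment y x"
  have sub: "?I \<subseteq> cball 0 1" using xy by (intro closed_segment_subset) auto
  have "norm (f x - f y - D f y (x - y)) \<le> norm (x - y) * (C * norm (x - y) powr \<alpha>)"
  proof (rule differentiable_bound_linearization[where S = ?I and f' = "D f" and ?x0.0 = y])
    show "y + t *\<^sub>R (x - y) \<in> ?I" if "t \<in> {0..1}" for t
      using that by (auto simp: in_segment algebra_simps intro!: exI[of _ t])
    show "(f has_derivative D f z) (at z within ?I)" if "z \<in> ?I" for z
      using has_derivative_subset[OF deriv[OF f] sub] that sub by blast
    show "onorm (D f z - D f y) \<le> C * norm (x - y) powr \<alpha>" if z: "z \<in> ?I" for z
    proof -
      have "norm (z - y) \<le> norm (x - y)" using segment_bound1[OF z] by simp
      then have "C * norm (z - y) powr \<alpha> \<le> C * norm (x - y) powr \<alpha>"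
        using C \<alpha> by (intro mult_left_mono powr_mono2) auto
      moreover have "norm (deriv_on (cball 0 1) f z - deriv_on (cball 0 1) f y) \<le> C * norm (z - y) powr \<alpha>"
        using hoelder[OF f] sub z xy by blast
      ultimately show ?thesis by (simp add: norm_blinfun.rep_eq minus_blinfun.rep_eq fun_diff_def)
    qed
  qed auto
  then show ?thesis by (simp add: mult_ac)
qed

text \<open>
  The increment \<open>word fs x - word fs y\<close> is compared with \<open>x - y\<close> after pulling it back to the
  starting point by the derivative of the word at \<open>y\<close>. If \<open>f\<close> is composed with a word of length \<open>n\<close>
  and the increment is \<open>d\<close>, the new pulled back vector differs from the old one, \<open>v\<close>, by the pullback \<open>u\<close>
  of the linearization error of \<open>f\<close>, which is at most \<open>C * norm d powr \<alpha> * norm d\<close>. Since \<open>d\<close> is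
  the image of \<open>v\<close> under the derivative of the word, the condition number \<open>T * q ^ n\<close> turns this into
  \<open>norm u \<le> T * q ^ n * K * C * norm d powr \<alpha> * norm v\<close>, and \<open>norm d \<le> L ^ n * norm (x - y)\<close>
  makes the factor geometric in \<open>n\<close> with ratio \<open>\<rho> = q * L powr \<alpha>\<close>. Pulling back to the starting
  point, rather than comparing operator norms step by step, is what keeps the errors summable.
\<close>
lemma pulled_back_difference:
  assumes T: "0 \<le> T" and q: "0 < q"
    and cond: "\<And>fs z h k. set fs \<subseteq> F \<Longrightarrow> z \<in> cball 0 1 \<Longrightarrow>
      norm (D (word fs) z h) * norm k \<le> T * q ^ length fs * norm h * norm (D (word fs) z k)"
    and fs: "set fs \<subseteq> F" and xy: "x \<in> cball 0 1" "y \<in> cball 0 1"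
  defines "\<rho> \<equiv> q * L powr \<alpha>" and "\<tau> \<equiv> T * K * C * norm (x - y) powr \<alpha>"
  shows "\<exists>v. D (word fs) y v = word fs x - word fs y \<and>
    norm (v - (x - y)) \<le> (exp (\<tau> * (\<Sum>j<length fs. \<rho> ^ j)) - 1) * norm (x - y)"
  using fs
proof (induction fs rule: rev_induct)
  case Nil
  have "(id has_derivative id) (at y within cball 0 1)" unfolding id_def by (rule has_derivative_ident)
  from deriv_on_eq[OF convex_nonempty_interior_cball xy(2) this] show ?case
    by (intro exI[of _ "x - y"]) (simp only: word_Nil, simp)
next
  case (snoc f fs)
  let ?n = "length fs" and ?W = "word fs" and ?N = "norm (x - y)"
  define E where "E = exp (\<tau> * (\<Sum>j<?n. \<rho> ^ j))"
  have fsF: "set fs \<subseteq> F" and fF: "f \<in> F" and sF: "set (fs @ [f]) \<subseteq> F" using snoc.prems by auto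
  obtain v where v: "D ?W y v = ?W x - ?W y" "norm (v - (x - y)) \<le> (E - 1) * ?N"
    using snoc.IH[OF fsF] by (auto simp: E_def)
  have W: "?W x \<in> cball 0 1" "?W y \<in> cball 0 1" using word_into[OF fsF] xy by auto
  define e where "e = f (?W x) - f (?W y) - D f (?W y) (?W x - ?W y)"
  obtain u where u: "D (word (fs @ [f])) y u = e"
    using deriv_word_surj[OF sF xy(2)] by (metis bij_pointE)
  have Df: "D (word (fs @ [f])) y h = D f (?W y) (D ?W y h)" for h
    using word_has_derivative(2)[OF sF xy(2)] by simp
  have \<rho>: "0 \<le> \<rho>" using q by (simp add: \<rho>_def)
  have \<tau>: "0 \<le> \<tau>" using T K C by (simp add: \<tau>_def)
  have small: "norm u \<le> \<tau> * \<rho> ^ ?n * norm v"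
  proof (cases "?W x = ?W y")
    case True
    then have "e = 0" by (simp add: e_def blinfun.zero_right)
    then have "u = 0" using u deriv_word_bounds[OF sF xy(2), of u] by simp
    then show ?thesis using \<tau> \<rho> by simp
  next
    case False
    define d where "d = norm (?W x - ?W y)"
    have d: "0 < d" "d = norm (D ?W y v)" using False v by (auto simp: d_def)
    have dL: "d \<le> L ^ ?n * ?N"
      using word_lipschitz[OF fsF xy] by (simp add: d_def dist_norm)
    have "d powr \<alpha> \<le> (L ^ ?n * ?N) powr \<alpha>" using d dL \<alpha> by (intro powr_mono2) auto
    also have "\<dots> = (L powr \<alpha>) ^ ?n * ?N powr \<alpha>"
      using L by (simp add: powr_mult powr_powr mult.commute flip: powr_realpow)
    finally have da: "d powr \<alpha> \<le> (L powr \<alpha>) ^ ?n * ?N powr \<alpha>" .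
    have "norm (D ?W y u) \<le> K * norm e"
      using deriv_lower[OF fF W(2), of "D ?W y u"] u Df by simp
    also have "\<dots> \<le> K * (C * d powr \<alpha> * d)"
      using linearization_error[OF fF W] K by (intro mult_left_mono) (auto simp: e_def d_def)
    finally have Pu: "norm (D ?W y u) \<le> K * (C * d powr \<alpha> * d)" .
    have "d * norm u \<le> T * q ^ ?n * norm v * norm (D ?W y u)"
      using cond[OF fsF xy(2), of v u] d by simp
    also have "\<dots> \<le> T * q ^ ?n * norm v * (K * (C * d powr \<alpha> * d))"
      using Pu T q by (intro mult_left_mono) auto
    also have "\<dots> = d * (T * q ^ ?n * norm v * K * C * d powr \<alpha>)" by (simp add: mult_ac)
    finally have "norm u \<le> T * q ^ ?n * norm v * K * C * d powr \<alpha>" using d(1) by simp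
    also have "\<dots> \<le> T * q ^ ?n * norm v * K * C * ((L powr \<alpha>) ^ ?n * ?N powr \<alpha>)"
      using da T q K C by (intro mult_left_mono) auto
    also have "\<dots> = \<tau> * \<rho> ^ ?n * norm v"
      by (simp add: \<tau>_def \<rho>_def power_mult_distrib mult_ac)
    finally show ?thesis .
  qed
  show ?case
  proof (intro exI[of _ "v + u"] conjI)
    have "D (word (fs @ [f])) y (v + u) = D f (?W y) (?W x - ?W y) + e"
      using u v(1) Df[of v] by (simp only: blinfun.add_right)
    also have "\<dots> = word (fs @ [f]) x - word (fs @ [f]) y" by (simp add: e_def word_snoc)
    finally show "D (word (fs @ [f])) y (v + u) = word (fs @ [f]) x - word (fs @ [f]) y" .
    have "norm v \<le> norm (v - (x - y)) + ?N" using norm_triangle_sub[of v "x - y"] by simp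
    then have vE: "norm v \<le> E * ?N" using v(2) by (simp add: algebra_simps)
    have "norm (v + u - (x - y)) \<le> norm (v - (x - y)) + norm u"
      using norm_triangle_ineq[of "v - (x - y)" u] by (simp add: algebra_simps)
    also have "\<dots> \<le> (E - 1) * ?N + \<tau> * \<rho> ^ ?n * (E * ?N)"
      using v(2) small mult_left_mono[OF vE, of "\<tau> * \<rho> ^ ?n"] \<tau> \<rho> by simp
    also have "\<dots> = (E * (1 + \<tau> * \<rho> ^ ?n) - 1) * ?N" by (simp add: algebra_simps)
    also have "\<dots> \<le> (E * exp (\<tau> * \<rho> ^ ?n) - 1) * ?N"
      using exp_ge_add_one_self[of "\<tau> * \<rho> ^ ?n"]
      by (intro mult_right_mono diff_right_mono mult_left_mono) (auto simp: E_def)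
    also have "E * exp (\<tau> * \<rho> ^ ?n) = exp (\<tau> * (\<Sum>j<length (fs @ [f]). \<rho> ^ j))"
      by (simp add: E_def distrib_left flip: exp_add)
    finally show "norm (v + u - (x - y)) \<le> (exp (\<tau> * (\<Sum>j<length (fs @ [f]). \<rho> ^ j)) - 1) * ?N" .
  qed
qed

lemma pulled_back_difference_uniform:
  assumes T: "0 \<le> T" and q: "0 < q" and \<rho>: "q * L powr \<alpha> < 1"
    and cond: "\<And>fs z h k. set fs \<subseteq> F \<Longrightarrow> z \<in> cball 0 1 \<Longrightarrow>
      norm (D (word fs) z h) * norm k \<le> T * q ^ length fs * norm h * norm (D (word fs) z k)"
    and fs: "set fs \<subseteq> F" and xy: "x \<in> cball 0 1" "y \<in> cball 0 1"
  defines "M \<equiv> T * K * C / (1 - q * L powr \<alpha>)"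
  shows "\<exists>v. D (word fs) y v = word fs x - word fs y \<and>
    norm (v - (x - y)) \<le> (exp (M * norm (x - y) powr \<alpha>) - 1) * norm (x - y)"
proof -
  let ?\<rho> = "q * L powr \<alpha>" and ?\<tau> = "T * K * C * norm (x - y) powr \<alpha>"
  have "0 \<le> ?\<rho>" using q by simp
  then have "(\<Sum>j<length fs. ?\<rho> ^ j) \<le> 1 / (1 - ?\<rho>)"
    using \<rho> by (simp add: sum_gp_strict divide_right_mono)
  then have "?\<tau> * (\<Sum>j<length fs. ?\<rho> ^ j) \<le> ?\<tau> * (1 / (1 - ?\<rho>))"
    using T K C by (intro mult_left_mono) auto
  then have "exp (?\<tau> * (\<Sum>j<length fs. ?\<rho> ^ j)) \<le> exp (M * norm (x - y) powr \<alpha>)"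
    by (simp add: M_def mult_ac)
  then have "(exp (?\<tau> * (\<Sum>j<length fs. ?\<rho> ^ j)) - 1) * norm (x - y)
      \<le> (exp (M * norm (x - y) powr \<alpha>) - 1) * norm (x - y)"
    by (intro mult_right_mono) auto
  with pulled_back_difference[OF T q cond fs xy] show ?thesis
    by (blast intro: order_trans)
qed

text \<open>
  A word that spreads some pair of points by more than \<open>\<delta>\<close> moves \<open>z\<close> and one of the two points
  \<open>\<delta>/2\<close> apart, so its derivative at \<open>z\<close> maps the vector \<open>w\<close>, of bounded length, to a vector longer
  than \<open>\<delta>/2\<close>. By the bound on the condition number it is large in every direction.
\<close>

lemma deriv_lower_of_spread:
  assumes T: "0 \<le> T" and q: "0 < q" and \<rho>: "q * L powr \<alpha> < 1"
    and cond: "\<And>fs z h k. set fs \<subseteq> F \<Longrightarrow> z \<in> cball 0 1 \<Longrightarrow>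
      norm (D (word fs) z h) * norm k \<le> T * q ^ length fs * norm h * norm (D (word fs) z k)"
    and fs: "set fs \<subseteq> F" and uv: "u \<in> cball 0 1" "v \<in> cball 0 1"
    and far: "\<delta> < dist (word fs u) (word fs v)" and z: "z \<in> cball 0 1"
  defines "M \<equiv> T * K * C / (1 - q * L powr \<alpha>)"
  shows "\<delta> * norm k \<le> 4 * T * exp (M * 2 powr \<alpha>) * q ^ length fs * norm (D (word fs) z k)"
proof -
  have "\<delta> < dist (word fs u) (word fs z) + dist (word fs v) (word fs z)"
    using far dist_triangle2[of "word fs u" "word fs v" "word fs z"] by simp
  then obtain p where p: "p \<in> cball 0 1" "\<delta> / 2 < dist (word fs p) (word fs z)"
    using uv by (metis add.commute field_sum_of_halves linorder_not_less add_mono)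
  obtain w where w: "D (word fs) z w = word fs p - word fs z"
    "norm (w - (p - z)) \<le> (exp (M * norm (p - z) powr \<alpha>) - 1) * norm (p - z)"
    using pulled_back_difference_uniform[OF T q \<rho> cond fs p(1) z] unfolding M_def by blast
  have M: "0 \<le> M" using T K C \<rho> by (simp add: M_def)
  have pz: "norm (p - z) \<le> 2" using p(1) z norm_triangle_ineq4[of p z] by simp
  have "norm w \<le> norm (w - (p - z)) + norm (p - z)" using norm_triangle_sub[of w "p - z"] by simp
  also have "\<dots> \<le> exp (M * norm (p - z) powr \<alpha>) * norm (p - z)" using w(2) by (simp add: algebra_simps)
  also have "\<dots> \<le> exp (M * 2 powr \<alpha>) * 2"
    using pz M \<alpha> by (intro mult_mono) (auto intro!: mult_left_mono powr_mono2)
  finally have w2: "norm w \<le> exp (M * 2 powr \<alpha>) * 2" .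
  have "\<delta> / 2 * norm k \<le> norm (D (word fs) z w) * norm k"
    using p(2) w(1) by (intro mult_right_mono) (auto simp: dist_norm)
  also have "\<dots> \<le> T * q ^ length fs * norm w * norm (D (word fs) z k)" by (rule cond[OF fs z])
  also have "\<dots> \<le> T * q ^ length fs * (exp (M * 2 powr \<alpha>) * 2) * norm (D (word fs) z k)"
    using w2 T q by (intro mult_right_mono mult_left_mono) auto
  finally show ?thesis by (simp add: mult_ac)
qed

lemma ex_small_powr: "0 \<le> B \<Longrightarrow> 0 < b \<Longrightarrow> \<exists>\<eta>>0. \<forall>t. 0 \<le> t \<and> t \<le> \<eta> \<longrightarrow> B * t powr \<alpha> \<le> b"
proof -
  assume B: "0 \<le> B" and b: "0 < b"
  define \<eta> where "\<eta> = (b / (B + 1)) powr (1 / \<alpha>)"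
  have "B * t powr \<alpha> \<le> b" if t: "0 \<le> t" "t \<le> \<eta>" for t
  proof -
    have "t powr \<alpha> \<le> \<eta> powr \<alpha>" using t \<alpha> by (intro powr_mono2) auto
    also have "\<dots> = b / (B + 1)" using \<alpha> B b by (simp add: \<eta>_def powr_powr)
    finally have "B * t powr \<alpha> \<le> B * (b / (B + 1))" using B by (intro mult_left_mono) auto
    also have "\<dots> \<le> b" using B b by (simp add: field_simps)
    finally show ?thesis .
  qed
  moreover have "0 < \<eta>" using B b by (simp add: \<eta>_def)
  ultimately show ?thesis by blast
qed

section \<open>Copies of the limit set\<close>

text \<open>
  The image of the ball need not be convex, so a bound on the inverse derivative gives no Lipschitz
  bound for the inverse map directly. For nearby points the linearization gives the estimate; for
  the others injectivity and compactness do.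
\<close>

lemma map_lower_lipschitz:
  assumes f: "f \<in> F"
  shows "\<exists>c>0. \<forall>x\<in>cball 0 1. \<forall>y\<in>cball 0 1. c * dist x y \<le> dist (f x) (f y)"
proof -
  obtain \<eta> where \<eta>: "0 < \<eta>" "\<And>t. 0 \<le> t \<Longrightarrow> t \<le> \<eta> \<Longrightarrow> C * t powr \<alpha> \<le> 1 / (2 * K)"
    using ex_small_powr[OF C, of "1 / (2 * K)"] K by auto
  have near: "1 / (2 * K) * dist x y \<le> dist (f x) (f y)"
    if xy: "x \<in> cball 0 1" "y \<in> cball 0 1" "dist x y \<le> \<eta>" for x y
  proof -
    have "norm (x - y) \<le> K * norm (D f y (x - y))" by (rule deriv_lower[OF f xy(2)])
    then have "1 / K * norm (x - y) \<le> norm (D f y (x - y))" using K by (simp add: field_simps)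
    moreover have "norm (D f y (x - y)) \<le> norm (f x - f y) + norm (f x - f y - D f y (x - y))"
      using norm_triangle_ineq4[of "f x - f y" "f x - f y - D f y (x - y)"] by simp
    moreover have "norm (f x - f y - D f y (x - y)) \<le> 1 / (2 * K) * norm (x - y)"
      using linearization_error[OF f xy(1,2)] xy(3) mult_right_mono[OF \<eta>(2)[of "norm (x - y)"], of "norm (x - y)"]
      by (simp add: dist_norm)
    moreover have "1 / K * norm (x - y) = 1 / (2 * K) * norm (x - y) + 1 / (2 * K) * norm (x - y)"
      using K by (simp add: field_simps)
    ultimately show ?thesis by (simp add: dist_norm)
  qed
  define P where "P = (cball (0::'a) 1 \<times> cball 0 1) \<inter> {p. \<eta> \<le> dist (fst p) (snd p)}"
  have "compact P" unfolding P_def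
    by (intro compact_Int_closed compact_Times compact_cball closed_Collect_le continuous_intros)
  have contf: "continuous_on (cball 0 1) f" using word_continuous[of "[f]"] f by (simp add: word_def)
  have "\<exists>m>0. \<forall>p\<in>P. m \<le> dist (f (fst p)) (f (snd p))"
  proof (cases "P = {}")
    case False
    have "continuous_on P (\<lambda>p. dist (f (fst p)) (f (snd p)))"
      by (intro continuous_on_dist continuous_on_compose2[OF contf] continuous_intros) (auto simp: P_def)
    from continuous_attains_inf[OF \<open>compact P\<close> False this]
    obtain p where p: "p \<in> P" "\<forall>r\<in>P. dist (f (fst p)) (f (snd p)) \<le> dist (f (fst r)) (f (snd r))" by blast
    have "fst p \<noteq> snd p" "fst p \<in> cball 0 1" "snd p \<in> cball 0 1" using p(1) \<eta>(1) by (auto simp: P_def)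
    then have "f (fst p) \<noteq> f (snd p)" using inj[OF f] by (auto dest: inj_onD)
    then show ?thesis using p(2) by (intro exI[of _ "dist (f (fst p)) (f (snd p))"]) auto
  qed (auto intro: exI[of _ 1])
  then obtain m where m: "0 < m" "\<And>x y. (x, y) \<in> P \<Longrightarrow> m \<le> dist (f x) (f y)" by fastforce
  define c where "c = min (1 / (2 * K)) (m / 2)"
  have c: "0 < c" "c \<le> 1 / (2 * K)" "c \<le> m / 2" using K m(1) by (auto simp: c_def)
  have "c * dist x y \<le> dist (f x) (f y)" if xy: "x \<in> cball 0 1" "y \<in> cball 0 1" for x y
  proof (cases "dist x y \<le> \<eta>")
    case True
    have "c * dist x y \<le> 1 / (2 * K) * dist x y" using c by (intro mult_right_mono) auto
    then show ?thesis using near[OF xy True] by simp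
  next
    case False
    then have "m \<le> dist (f x) (f y)" using xy by (intro m(2)) (auto simp: P_def)
    moreover have "dist x y \<le> 2" using xy dist_triangle2[of x y 0] by (simp add: dist_commute)
    then have "c * dist x y \<le> m / 2 * 2" using c m by (intro mult_mono) auto
    ultimately show ?thesis by simp
  qed
  then show ?thesis using c(1) by blast
qed

text \<open>
  A power of a single map. It is applied first, to bring all points of the limit set so
  close together that the linearization of further words is accurate.
\<close>

lemma ex_small_bilipschitz_word:
  assumes \<eta>: "0 < \<eta>"
  shows "\<exists>gs c. set gs \<subseteq> F \<and> 0 < c \<and> (\<forall>x\<in>cball 0 1. \<forall>y\<in>cball 0 1.
    dist (word gs x) (word gs y) \<le> \<eta> \<and> c * dist x y \<le> dist (word gs x) (word gs y))"
proof -
  obtain f where f: "f \<in> F" using nonempty by blast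
  obtain c where c: "0 < c" "\<And>x y. x \<in> cball 0 1 \<Longrightarrow> y \<in> cball 0 1 \<Longrightarrow> c * dist x y \<le> dist (f x) (f y)"
    using map_lower_lipschitz[OF f] by blast
  have low: "c ^ n * dist x y \<le> dist (word (replicate n f) x) (word (replicate n f) y)"
    if "x \<in> cball 0 1" "y \<in> cball 0 1" for n x y
    using that
  proof (induction n arbitrary: x y)
    case (Suc n)
    have "f x \<in> cball 0 1" "f y \<in> cball 0 1" using into[OF f] Suc.prems by blast+
    note Suc.IH[OF this]
    moreover have "c ^ n * (c * dist x y) \<le> c ^ n * dist (f x) (f y)"
      using c(2)[OF Suc.prems] c(1) by (intro mult_left_mono) auto
    ultimately show ?case by (simp add: word_Cons mult_ac)
  qed (simp add: word_Nil)
  obtain n where n: "2 * L ^ n < \<eta>" using ex_word_contraction[OF \<eta>] by blast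
  have "set (replicate n f) \<subseteq> F" using f by auto
  then show ?thesis
    using low word_dist_le[of "replicate n f"] n c(1)
    by (intro exI[of _ "replicate n f"] exI[of _ "c ^ n"]) fastforce
qed

text \<open>
  Among the words of which \<open>x\<close> is an image and that shrink the ball to diameter at most \<open>\<delta>\<close>, take a shortest one.
  Its innermost letter is \<open>g\<close>, and \<open>x\<close> is still an image under the remaining word \<open>fs\<close>, which by
  minimality does not shrink the ball to diameter \<open>\<delta>\<close>.
\<close>

lemma ex_word_at_scale:
  assumes x: "x \<in> limit_set F" and \<delta>: "0 < \<delta>" "\<delta> < 1"
  shows "\<exists>g fs z u v. set (g # fs) \<subseteq> F \<and> z \<in> limit_set F \<and> x = word (g # fs) z \<and>
    (\<forall>s\<in>cball 0 1. \<forall>t\<in>cball 0 1. dist (word (g # fs) s) (word (g # fs) t) \<le> \<delta>) \<and>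
    u \<in> cball 0 1 \<and> v \<in> cball 0 1 \<and> \<delta> < dist (word fs u) (word fs v)"
proof -
  have inv: "ifs_map F (limit_set F) = limit_set F" using limit_set_invariant by blast
  define small where "small fs \<longleftrightarrow> (\<forall>s\<in>cball 0 1. \<forall>t\<in>cball 0 1. dist (word fs s) (word fs t) \<le> \<delta>)"
    for fs :: "('a \<Rightarrow> 'a) list"
  define P where "P n \<longleftrightarrow> (\<exists>fs z. length fs = n \<and> set fs \<subseteq> F \<and> z \<in> limit_set F \<and> x = word fs z \<and> small fs)" for n
  obtain n where n: "2 * L ^ n < \<delta>" using ex_word_contraction[OF \<delta>(1)] by blast
  obtain fs z where fs: "length fs = n" "set fs \<subseteq> F" "z \<in> limit_set F" "x = word fs z"
    using invariant_address[OF inv x] by blast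
  have "small fs" unfolding small_def
  proof (intro ballI)
    fix s t :: 'a assume "s \<in> cball 0 1" "t \<in> cball 0 1"
    from word_dist_le[OF fs(2) this] show "dist (word fs s) (word fs t) \<le> \<delta>" using n fs(1) by simp
  qed
  then have "P n" using fs unfolding P_def by blast
  then obtain m where m: "P m" "\<And>k. k < m \<Longrightarrow> \<not> P k" using exists_least_iff[of P] by blast
  then obtain hs z where hs: "length hs = m" "set hs \<subseteq> F" "z \<in> limit_set F" "x = word hs z" "small hs"
    unfolding P_def by blast
  show ?thesis
  proof (cases hs)
    case Nil
    obtain e :: 'a where e: "norm e = 1" using vector_choose_size[of 1] by auto
    have "dist (word hs e) (word hs 0) \<le> \<delta>" using hs(5) e by (simp add: small_def)
    then show ?thesis using e \<delta> by (simp add: Nil word_Nil)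
  next
    case (Cons g fs)
    have "g z \<in> limit_set F" using invariant_word[OF inv hs(3), of "[g]"] hs(2) Cons by (simp add: word_def)
    moreover have "\<not> P (length fs)" using m(2) hs(1) Cons by simp
    ultimately have "\<not> small fs" using hs Cons unfolding P_def by (auto simp: word_Cons)
    then obtain u v where "u \<in> cball 0 1" "v \<in> cball 0 1" "\<delta> < dist (word fs u) (word fs v)"
      unfolding small_def by (meson not_le)
    then show ?thesis using hs Cons unfolding small_def by blast
  qed
qed

text \<open>
  The copy of the limit set near \<open>x\<close> is its image under \<open>word (g # fs) \<circ> word gs\<close>, with \<open>g # fs\<close>
  the word at scale \<open>\<delta>\<close> and \<open>gs\<close> the fixed word that brings points together. The derivative of \<open>fs\<close>
  is bounded below by \<open>\<delta>\<close> up to its condition number, the extra letter \<open>g\<close> costs a factor \<open>K\<close>, and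
  the linearization turns this into a lower bound for distances. The condition number grows like
  \<open>q ^ n\<close> for a word of length \<open>n\<close>; with \<open>q = L powr (- a)\<close> it is \<open>(L ^ n) powr (- a)\<close>, and since a
  word that spreads points by more than \<open>\<delta>\<close> satisfies \<open>\<delta> < 2 * L ^ n\<close>, it costs at most a constant
  times \<open>\<delta> powr (- a)\<close>. The restriction \<open>a < \<alpha>\<close> is the summability condition \<open>q * L powr \<alpha> < 1\<close>.
\<close>

lemma expanding_copies:
  assumes cond: "\<And>\<epsilon>. 0 < \<epsilon> \<Longrightarrow> \<exists>T>0. \<forall>fs z h k. set fs \<subseteq> F \<longrightarrow> z \<in> cball 0 1 \<longrightarrow>
      norm (D (word fs) z h) * norm k \<le> T * exp \<epsilon> ^ length fs * norm h * norm (D (word fs) z k)"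
    and a: "0 < a" "a < \<alpha>"
  shows "\<exists>c>0. \<forall>\<delta> x. 0 < \<delta> \<longrightarrow> \<delta> < 1 \<longrightarrow> x \<in> limit_set F \<longrightarrow>
    (\<exists>\<phi>. continuous_on (limit_set F) \<phi> \<and> \<phi> ` limit_set F \<subseteq> limit_set F \<inter> cball x \<delta> \<and>
      (\<forall>u\<in>limit_set F. \<forall>v\<in>limit_set F. c * \<delta> powr (1 + a) * dist u v \<le> dist (\<phi> u) (\<phi> v)))"
proof -
  let ?\<Lambda> = "limit_set F"
  have inv: "ifs_map F ?\<Lambda> = ?\<Lambda>" using limit_set_invariant by blast
  have sub: "u \<in> cball 0 1" if "u \<in> ?\<Lambda>" for u using that limit_set_compact(3) by blast
  define q where "q = L powr (- a)"
  have q: "0 < q" using L by (simp add: q_def)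
  have qe: "q = exp (a * - ln L)" using L by (simp add: q_def powr_def)
  have "0 < a * - ln L" using a L by (simp add: mult_less_0_iff)
  from cond[OF this] obtain T where T: "0 < T" and
    cT: "\<And>fs z h k. set fs \<subseteq> F \<Longrightarrow> z \<in> cball 0 1 \<Longrightarrow>
      norm (D (word fs) z h) * norm k \<le> T * q ^ length fs * norm h * norm (D (word fs) z k)"
    unfolding qe by blast
  have T0: "0 \<le> T" using T by simp
  have "q * L powr \<alpha> = L powr (\<alpha> - a)" using L by (simp add: q_def flip: powr_add)
  also have "\<dots> < 1" using L a powr_less_mono2[of "\<alpha> - a" L 1] by simp
  finally have \<rho>: "q * L powr \<alpha> < 1" .
  define M where "M = T * K * C / (1 - q * L powr \<alpha>)"
  have M: "0 \<le> M" using T K C \<rho> by (simp add: M_def)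
  \<comment> \<open>For points at distance at most \<open>\<eta>\<close> the pulled back difference is off by at most half of its
    length.\<close>
  obtain \<eta> where \<eta>: "0 < \<eta>" "\<And>t. 0 \<le> t \<Longrightarrow> t \<le> \<eta> \<Longrightarrow> M * t powr \<alpha> \<le> ln (3/2)"
    using ex_small_powr[OF M, of "ln (3/2)"] by auto
  obtain gs c0 where gs: "set gs \<subseteq> F" and c0: "0 < c0" and
    gsd: "\<And>x y. x \<in> cball 0 1 \<Longrightarrow> y \<in> cball 0 1 \<Longrightarrow> dist (word gs x) (word gs y) \<le> \<eta>"
      "\<And>x y. x \<in> cball 0 1 \<Longrightarrow> y \<in> cball 0 1 \<Longrightarrow> c0 * dist x y \<le> dist (word gs x) (word gs y)"
    using ex_small_bilipschitz_word[OF \<eta>(1)] by blast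
  define B where "B = 4 * T * exp (M * 2 powr \<alpha>)"
  have B: "0 < B" using T by (simp add: B_def)
  define c where "c = c0 / (2 * K * B * 2 powr a)"
  have c: "0 < c" using c0 K B by (simp add: c_def)
  have "\<exists>\<phi>. continuous_on ?\<Lambda> \<phi> \<and> \<phi> ` ?\<Lambda> \<subseteq> ?\<Lambda> \<inter> cball x \<delta> \<and>
      (\<forall>u\<in>?\<Lambda>. \<forall>v\<in>?\<Lambda>. c * \<delta> powr (1 + a) * dist u v \<le> dist (\<phi> u) (\<phi> v))"
    if \<delta>: "0 < \<delta>" "\<delta> < 1" and x: "x \<in> ?\<Lambda>" for \<delta> x
  proof -
    obtain g fs z u0 v0 where gfs: "set (g # fs) \<subseteq> F" and z: "z \<in> ?\<Lambda>" "x = word (g # fs) z"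
      and le: "\<And>s t. s \<in> cball 0 1 \<Longrightarrow> t \<in> cball 0 1 \<Longrightarrow> dist (word (g # fs) s) (word (g # fs) t) \<le> \<delta>"
      and uv0: "u0 \<in> cball 0 1" "v0 \<in> cball 0 1" "\<delta> < dist (word fs u0) (word fs v0)"
      using ex_word_at_scale[OF x \<delta>] by blast
    have fs: "set fs \<subseteq> F" and gF: "g \<in> F" using gfs by auto
    let ?W = "word (g # fs)" and ?n = "length fs"
    have "\<delta> < 2 * L ^ ?n" using uv0(3) word_dist_le[OF fs uv0(1,2)] by simp
    then have "(L ^ ?n) powr (- a) \<le> (\<delta> / 2) powr (- a)"
      using \<delta> a by (intro powr_mono2') auto
    moreover have "(L ^ ?n) powr (- a) = q ^ ?n"
      using L by (simp add: q_def powr_powr mult.commute flip: powr_realpow)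
    moreover have "(\<delta> / 2) powr (- a) = 2 powr a * \<delta> powr (- a)"
      using \<delta> by (simp add: powr_divide powr_minus field_simps)
    ultimately have qn: "q ^ ?n \<le> 2 powr a * \<delta> powr (- a)" by simp
    have lower: "c * \<delta> powr (1 + a) * dist u v \<le> dist (?W (word gs u)) (?W (word gs v))"
      if uv: "u \<in> ?\<Lambda>" "v \<in> ?\<Lambda>" for u v
    proof -
      define p r where "p = word gs u" and "r = word gs v"
      have pr: "p \<in> cball 0 1" "r \<in> cball 0 1" "norm (p - r) \<le> \<eta>" "c0 * dist u v \<le> norm (p - r)"
        using word_into[OF gs] gsd sub uv by (auto simp: p_def r_def dist_norm simp del: mem_cball)
      obtain w where w: "D ?W r w = ?W p - ?W r"
        "norm (w - (p - r)) \<le> (exp (M * norm (p - r) powr \<alpha>) - 1) * norm (p - r)"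
        using pulled_back_difference_uniform[OF T0 q \<rho> cT gfs pr(1,2)] unfolding M_def by blast
      have "exp (M * norm (p - r) powr \<alpha>) \<le> exp (ln (3/2))"
        using \<eta>(2)[OF _ pr(3)] unfolding exp_le_cancel_iff by simp
      also have "exp (ln (3/2)) = (3/2::real)" by simp
      finally have "exp (M * norm (p - r) powr \<alpha>) - 1 \<le> 1 / 2" by simp
      then have "(exp (M * norm (p - r) powr \<alpha>) - 1) * norm (p - r) \<le> 1 / 2 * norm (p - r)"
        by (intro mult_right_mono) auto
      moreover have "norm (p - r) \<le> norm w + norm (w - (p - r))"
        using norm_triangle_ineq4[of w "w - (p - r)"] by simp
      ultimately have w_low: "norm (p - r) \<le> 2 * norm w" using w(2) by linarith
      have gr: "g r \<in> cball 0 1" using into[OF gF] pr(2) by blast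
      have "\<delta> * norm (D g r w) \<le> B * q ^ ?n * norm (D (word fs) (g r) (D g r w))"
        using deriv_lower_of_spread[OF T0 q \<rho> cT fs uv0 gr, of "D g r w"] unfolding B_def M_def .
      also have "D (word fs) (g r) (D g r w) = ?W p - ?W r"
        using w(1) deriv_word_Cons[OF gfs pr(2)] by simp
      also have "B * q ^ ?n * norm (?W p - ?W r) \<le> B * (2 powr a * \<delta> powr (- a)) * norm (?W p - ?W r)"
        using qn B by (intro mult_right_mono mult_left_mono) auto
      finally have "\<delta> * \<delta> powr a * norm (D g r w) \<le> B * 2 powr a * norm (?W p - ?W r)"
        using \<delta> by (simp add: powr_minus field_simps)
      then have main: "\<delta> powr (1 + a) * norm (D g r w) \<le> B * 2 powr a * norm (?W p - ?W r)"
        using \<delta> by (simp add: powr_add)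
      have duv: "c0 * dist u v \<le> 2 * (K * norm (D g r w))"
        using pr(4) w_low deriv_lower[OF gF pr(2), of w] by linarith
      have "c0 * dist u v * \<delta> powr (1 + a) \<le> 2 * (K * norm (D g r w)) * \<delta> powr (1 + a)"
        using duv by (intro mult_right_mono) auto
      also have "\<dots> = 2 * K * (\<delta> powr (1 + a) * norm (D g r w))" by (simp add: mult_ac)
      also have "\<dots> \<le> 2 * K * (B * 2 powr a * norm (?W p - ?W r))"
        using main K by (intro mult_left_mono) auto
      finally have "c0 * dist u v * \<delta> powr (1 + a) \<le> 2 * K * (B * 2 powr a * norm (?W p - ?W r))" .
      then show ?thesis
        using K B by (simp add: c_def p_def r_def dist_norm field_simps)
    qed
    have gsL: "word gs u \<in> ?\<Lambda>" if "u \<in> ?\<Lambda>" for u using invariant_word[OF inv that gs] .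
    show ?thesis
    proof (intro exI[of _ "?W \<circ> word gs"] conjI)
      show "continuous_on ?\<Lambda> (?W \<circ> word gs)"
      proof (rule continuous_on_compose)
        show "continuous_on ?\<Lambda> (word gs)"
          by (rule continuous_on_subset[OF word_continuous[OF gs] limit_set_compact(3)])
        have "word gs ` ?\<Lambda> \<subseteq> cball 0 1" using word_into[OF gs] sub by blast
        then show "continuous_on (word gs ` ?\<Lambda>) ?W"
          by (rule continuous_on_subset[OF word_continuous[OF gfs]])
      qed
      show "(?W \<circ> word gs) ` ?\<Lambda> \<subseteq> ?\<Lambda> \<inter> cball x \<delta>"
        using gsL invariant_word[OF inv _ gfs] le[OF sub[OF z(1)] sub[OF gsL]] z(2) by auto
      show "\<forall>u\<in>?\<Lambda>. \<forall>v\<in>?\<Lambda>. c * \<delta> powr (1 + a) * dist u v \<le> dist ((?W \<circ> word gs) u) ((?W \<circ> word gs) v)"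
        using lower by simp
    qed
  qed
  then show ?thesis using c by blast
qed

section \<open>Condition numbers of semi-conformal systems\<close>

text \<open>
  For words of length at least \<open>N\<close> this is the definition. The short words are absorbed into \<open>T\<close>
  by the uniform bounds on the derivatives of the maps and of their inverses. The same bounds show that
  the supremum in the definition is taken over a bounded set, so that it is an upper bound at
  all. The estimate is phrased without inverse operators, which is the form in which it is applied.
\<close>

lemma semi_conformal_condition:
  assumes sc: "F \<in> semi_conformal L' \<alpha>'" and \<epsilon>: "0 < \<epsilon>"
  shows "\<exists>T>0. \<forall>fs z h k. set fs \<subseteq> F \<longrightarrow> z \<in> cball 0 1 \<longrightarrow>
      norm (D (word fs) z h) * norm k \<le> T * exp \<epsilon> ^ length fs * norm h * norm (D (word fs) z k)"
proof -
  define \<kappa> where "\<kappa> fs z = onorm (D (word fs) z) * onorm (inv (D (word fs) z))" for fs z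
  define R where "R n = (SUP (fs, z) \<in> {fs. length fs = n \<and> set fs \<subseteq> F} \<times> cball 0 1. 1 / real n * ln (\<kappa> fs z))" for n
  have "R \<longlonglongrightarrow> 0"
    using sc unfolding semi_conformal_def R_def \<kappa>_def word_def Let_def by simp
  then have "\<forall>\<^sub>F n in sequentially. R n < \<epsilon>" using \<epsilon> by (rule order_tendstoD)
  then obtain N where N: "\<And>n. N \<le> n \<Longrightarrow> R n < \<epsilon>" unfolding eventually_sequentially by blast
  obtain e :: 'a where e: "norm e = 1" using vector_choose_size[of 1] by auto
  have K1: "1 \<le> K"
  proof -
    obtain f where f: "f \<in> F" using nonempty by blast
    have "1 \<le> K * norm (D f 0 e)" using deriv_lower[OF f, of 0 e] e by simp
    also have "\<dots> \<le> K * (K * 1)" using deriv_upper[OF f, of 0 e] e K by (intro mult_left_mono) auto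
    finally have "1 \<le> K ^ 2" by (simp add: power2_eq_square)
    then show ?thesis using K abs_le_square_iff[of 1 K] by simp
  qed
  have linA: "bounded_linear (D (word fs) z)" for fs z by (rule blinfun.bounded_linear_right)
  have invB: "bounded_linear (inv (D (word fs) z))" "\<And>h. inv (D (word fs) z) (D (word fs) z h) = h"
    "onorm (D (word fs) z) \<le> K ^ length fs" "onorm (inv (D (word fs) z)) \<le> K ^ length fs"
    if fs: "set fs \<subseteq> F" and z: "z \<in> cball 0 1" for fs z
  proof -
    have bij: "bij (D (word fs) z)" by (rule deriv_word_surj[OF fs z])
    have "linear (inv (D (word fs) z))"
      using bounded_linear.linear[OF linA] bij by (intro inj_linear_imp_inv_linear) (auto simp: bij_def)
    then show "bounded_linear (inv (D (word fs) z))" by (simp add: linear_conv_bounded_linear)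
    show inv: "\<And>h. inv (D (word fs) z) (D (word fs) z h) = h" using bij by (simp add: bij_def)
    show "onorm (D (word fs) z) \<le> K ^ length fs"
      using deriv_word_bounds[OF fs z] K by (intro onorm_bound) auto
    show "onorm (inv (D (word fs) z)) \<le> K ^ length fs"
    proof (intro onorm_bound)
      fix y
      obtain h where "y = D (word fs) z h" using bij by (metis bij_pointE)
      then show "norm (inv (D (word fs) z) y) \<le> K ^ length fs * norm y"
        using inv deriv_word_bounds[OF fs z, of h] by simp
    qed (use K in auto)
  qed
  have \<kappa>1: "1 \<le> \<kappa> fs z" and \<kappa>K: "\<kappa> fs z \<le> K ^ (2 * length fs)"
    if fs: "set fs \<subseteq> F" and z: "z \<in> cball 0 1" for fs z
  proof -
    have "1 = norm (inv (D (word fs) z) (D (word fs) z e))" using invB(2)[OF fs z] e by simp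
    also have "\<dots> \<le> onorm (inv (D (word fs) z)) * norm (D (word fs) z e)" by (rule onorm[OF invB(1)[OF fs z]])
    also have "\<dots> \<le> onorm (inv (D (word fs) z)) * (onorm (D (word fs) z) * norm e)"
      using onorm_pos_le[OF invB(1)[OF fs z]] by (intro mult_left_mono onorm[OF linA])
    finally show "1 \<le> \<kappa> fs z" using e by (simp add: \<kappa>_def mult.commute)
    have "\<kappa> fs z \<le> K ^ length fs * K ^ length fs"
      unfolding \<kappa>_def using invB(3,4)[OF fs z] K onorm_pos_le[OF invB(1)[OF fs z]] by (intro mult_mono) auto
    then show "\<kappa> fs z \<le> K ^ (2 * length fs)" by (simp add: mult_2 power_add)
  qed
  define m where "m = max N 1"
  define T where "T = K ^ (2 * m)"
  have T: "1 \<le> T" using K1 by (simp add: T_def)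
  have bound: "\<kappa> fs z \<le> T * exp \<epsilon> ^ length fs" if fs: "set fs \<subseteq> F" and z: "z \<in> cball 0 1" for fs z
  proof (cases "m \<le> length fs")
    case True
    then have n: "N \<le> length fs" "0 < length fs" by (auto simp: m_def)
    let ?n = "length fs"
    have "1 / real ?n * ln (\<kappa> fs z) \<le> R ?n"
    proof -
      have "bdd_above ((\<lambda>(gs, z). 1 / real ?n * ln (\<kappa> gs z)) ` ({gs. length gs = ?n \<and> set gs \<subseteq> F} \<times> cball 0 1))"
      proof (rule bdd_aboveI2, clarify)
        fix gs and y :: 'a assume gs: "length gs = ?n" "set gs \<subseteq> F" and y: "y \<in> cball 0 1"
        have "ln (\<kappa> gs y) \<le> ln (K ^ (2 * ?n))"
          using \<kappa>1[OF gs(2) y] \<kappa>K[OF gs(2) y] gs(1) by simp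
        then show "1 / real ?n * ln (\<kappa> gs y) \<le> 1 / real ?n * ln (K ^ (2 * ?n))"
          by (intro mult_left_mono) auto
      qed
      from cSUP_upper[OF _ this, of "(fs, z)"] show ?thesis using fs z by (simp add: R_def)
    qed
    also have "\<dots> \<le> \<epsilon>" using N[OF n(1)] by simp
    finally have "ln (\<kappa> fs z) \<le> real ?n * \<epsilon>" using n(2) by (simp add: field_simps)
    then have "exp (ln (\<kappa> fs z)) \<le> exp (real ?n * \<epsilon>)" by simp
    then have "\<kappa> fs z \<le> exp (real ?n * \<epsilon>)" using \<kappa>1[OF fs z] by simp
    also have "\<dots> = 1 * exp \<epsilon> ^ ?n" by (simp add: exp_of_nat_mult)
    also have "\<dots> \<le> T * exp \<epsilon> ^ ?n" using T by (intro mult_right_mono) auto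
    finally show ?thesis .
  next
    case False
    have "\<kappa> fs z \<le> K ^ (2 * length fs)" by (rule \<kappa>K[OF fs z])
    also have "\<dots> \<le> T * 1" unfolding T_def using False K1 by (simp add: power_increasing)
    also have "\<dots> \<le> T * exp \<epsilon> ^ length fs" using T \<epsilon> by (intro mult_left_mono one_le_power) auto
    finally show ?thesis .
  qed
  have "norm (D (word fs) z h) * norm k \<le> T * exp \<epsilon> ^ length fs * norm h * norm (D (word fs) z k)"
    if fs: "set fs \<subseteq> F" and z: "z \<in> cball 0 1" for fs z h k
  proof -
    have "norm k \<le> onorm (inv (D (word fs) z)) * norm (D (word fs) z k)"
      using onorm[OF invB(1)[OF fs z], of "D (word fs) z k"] invB(2)[OF fs z] by simp
    then have "norm (D (word fs) z h) * norm k
        \<le> (onorm (D (word fs) z) * norm h) * (onorm (inv (D (word fs) z)) * norm (D (word fs) z k))"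
      using onorm[OF linA] onorm_pos_le[OF linA] by (intro mult_mono) auto
    also have "\<dots> = \<kappa> fs z * (norm h * norm (D (word fs) z k))" by (simp add: \<kappa>_def mult_ac)
    also have "\<dots> \<le> T * exp \<epsilon> ^ length fs * (norm h * norm (D (word fs) z k))"
      by (intro mult_right_mono bound[OF fs z]) auto
    finally show ?thesis by (simp add: mult_ac)
  qed
  then show ?thesis using T by (intro exI[of _ T]) auto
qed

end

section \<open>Equality of the dimensions\<close>

lemma DIFS_contracting_system:
  fixes F :: "('a::euclidean_space \<Rightarrow> 'a) set"
  assumes L: "0 < L" "L < 1" and \<alpha>: "0 < \<alpha>" and F: "F \<in> DIFS L \<alpha>"
  shows "\<exists>C K. contracting_system F L \<alpha> C K"
proof -
  have \<alpha>0: "0 \<le> \<alpha>" using \<alpha> by simp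
  have FD: "F \<subseteq> D1 L \<alpha>" by (rule DIFS_subset_D1[OF \<alpha>0 F])
  obtain C where C: "\<And>f. f \<in> F \<Longrightarrow> hoelder_deriv_with \<alpha> C (cball 0 1) f"
    using F by (auto simp: DIFS_def)
  obtain K where K: "0 < K" "\<And>f x h. f \<in> F \<Longrightarrow> x \<in> cball 0 1 \<Longrightarrow>
      norm h \<le> K * norm (blinfun_apply (deriv_on (cball 0 1) f x) h) \<and>
      norm (blinfun_apply (deriv_on (cball 0 1) f x) h) \<le> K * norm h"
    using DIFS_deriv_bounds[OF \<alpha>0 F] by blast
  have "contracting_system F L \<alpha> \<bar>C\<bar> K"
  proof
    show "F \<noteq> {}" using F by (simp add: DIFS_def)
    fix f assume f: "f \<in> F"
    then have fD: "f \<in> D1 L \<alpha>" using FD by blast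
    then have diffeo: "diffeo_onto_image (cball 0 1) f" by (simp add: D1_def)
    have "f ` cball 0 1 \<subseteq> ball 0 1" using fD by (simp add: D1_def)
    then show "f ` cball 0 1 \<subseteq> cball 0 1" using ball_subset_cball by (rule order_trans)
    show "inj_on f (cball 0 1)" using diffeo by (simp add: diffeo_onto_image_def)
    show "(f has_derivative blinfun_apply (deriv_on (cball 0 1) f x)) (at x within cball 0 1)"
      if "x \<in> cball 0 1" for x
      using diffeo that convex_nonempty_interior_cball
      by (intro C1_on_deriv_on(1)) (auto simp: diffeo_onto_image_def)
    show "dist (f x) (f y) \<le> L * dist x y" if "x \<in> cball 0 1" "y \<in> cball 0 1" for x y
      using fD that by (auto simp: D1_def dest: lipschitz_onD)
    show "norm (deriv_on (cball 0 1) f x - deriv_on (cball 0 1) f y) \<le> \<bar>C\<bar> * norm (x - y) powr \<alpha>"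
      if "x \<in> cball 0 1" "y \<in> cball 0 1" for x y
    proof -
      have "norm (deriv_on (cball 0 1) f x - deriv_on (cball 0 1) f y) \<le> C * norm (x - y) powr \<alpha>"
        using C[OF f] that unfolding hoelder_deriv_with_def by blast
      also have "\<dots> \<le> \<bar>C\<bar> * norm (x - y) powr \<alpha>" by (intro mult_right_mono) auto
      finally show ?thesis .
    qed
    show "norm h \<le> K * norm (blinfun_apply (deriv_on (cball 0 1) f x) h)"
      "norm (blinfun_apply (deriv_on (cball 0 1) f x) h) \<le> K * norm h" if "x \<in> cball 0 1" for x h
      using K(2)[OF f that] by blast+
  next
    show "closed (ifs_map F A)" if "compact A" "A \<subseteq> cball 0 1" for A
      by (rule DIFS_closed_image[OF \<alpha>0 F that])
  qed (use L \<alpha> K in auto)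
  then show ?thesis by blast
qed

theorem corollary1p8:
  fixes L \<alpha> :: real
    and F :: "(real ^ 'q \<Rightarrow> real ^ 'q) set"
  assumes "0 < L" "L < 1" "0 < \<alpha>" "\<alpha> \<le> 1"
    and "F \<in> semi_conformal L \<alpha> \<inter> DIFS L \<alpha>"
  shows "hausdorff_dim (limit_set F) = limit_capacity (limit_set F)"
proof -
  have sc: "F \<in> semi_conformal L \<alpha>" and F: "F \<in> DIFS L \<alpha>" using assms(5) by auto
  obtain C K where "contracting_system F L \<alpha> C K"
    using DIFS_contracting_system[OF assms(1-3) F] by blast
  then interpret contracting_system F L \<alpha> C K .
  show ?thesis
  proof (rule order_antisym)
    show "hausdorff_dim (limit_set F) \<le> limit_capacity (limit_set F)"
      by (rule hausdorff_dim_le_limit_capacity[OF limit_set_compact(1,2)])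
    show "limit_capacity (limit_set F) \<le> hausdorff_dim (limit_set F)"
      by (rule limit_capacity_le_hausdorff_dim[OF limit_set_compact(1,2) assms(3)
            expanding_copies[OF semi_conformal_condition[OF sc]]])
  qed
qed

end
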